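(* Let $X$ be a complex Banach space, $T\in\mathcal{L}(X)$ power-bounded, and let $F\in\mathbb{P}(\mathbb{Z}^+)$ be aperiodic. Then $$\sup_{n\in\mathbb{N}} n^{1/2}\|\Psi(F;T)^n-\Psi(F;T)^{n+1}\|<\infty,$$ and there exists $\beta\in(0,1)$ such that $$\sigma(\Psi(F;T))\subseteq\{z\in\mathbb{C}:|z-(1-\beta)|\le\beta\}\subseteq\mathbb{D}\cup\{1\}.$$
   Context: $T$ is power-bounded if $\sup_{n\in\mathbb{N}}\|T^n\|<\infty$. $\mathbb{P}(\mathbb{Z})$ is the set of probabilities on $\mathbb{Z}$ (functions $F:\mathbb{Z}\to[0,1]$ with $\sum_kF(k)=1$), $\mathbb{P}(\mathbb{Z}^+)$ those supported in $\mathbb{Z}^+=\{0,1,2,\dots\}$. $F\in\mathbb{P}(\mathbb{Z})$ is adapted if $\mathrm{supp}(F)=\{k:F(k)\ne0\}$ generates the additive group $\mathbb{Z}$, and aperiodic if every translate $\delta_m*F$ ($m\in\mathbb{Z}$) is adapted, where $\delta_m$ is the point mass at $m$ and $*$ is convolution. $\Psi(F;T)=\sum_{k\ge0}F(k)T^k$ with $T^0=I$. $\mathbb{D}=\{|z|<1\}$. *)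

theory Defs
  imports "HOL-Analysis.Analysis"
begin

class complex_normed_vector = real_normed_vector +
  fixes scaleC :: "complex \<Rightarrow> 'a \<Rightarrow> 'a" (infixr \<open>*\<^sub>C\<close> 75)
  assumes scaleC_add_right: "a *\<^sub>C (x + y) = a *\<^sub>C x + a *\<^sub>C y"
    and scaleC_add_left: "(a + b) *\<^sub>C x = a *\<^sub>C x + b *\<^sub>C x"
    and scaleC_scaleC: "a *\<^sub>C (b *\<^sub>C x) = (a * b) *\<^sub>C x"
    and scaleC_one: "1 *\<^sub>C x = x"
    and scaleR_scaleC: "r *\<^sub>R x = complex_of_real r *\<^sub>C x"
    and norm_scaleC: "norm (a *\<^sub>C x) = cmod a * norm x"

class complex_banach = complex_normed_vector + banach

text \<open>Membership in L(X): a bounded real-linear operator that is complex-linear.\<close>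
definition clinear_op :: "('a::complex_normed_vector \<Rightarrow>\<^sub>L 'a) \<Rightarrow> bool" where
  "clinear_op T \<longleftrightarrow> (\<forall>c x. blinfun_apply T (c *\<^sub>C x) = c *\<^sub>C blinfun_apply T x)"

primrec blinfun_pow :: "('a::real_normed_vector \<Rightarrow>\<^sub>L 'a) \<Rightarrow> nat \<Rightarrow> ('a \<Rightarrow>\<^sub>L 'a)" where
  "blinfun_pow T 0 = id_blinfun"
| "blinfun_pow T (Suc n) = T o\<^sub>L blinfun_pow T n"

definition power_bounded :: "('a::real_normed_vector \<Rightarrow>\<^sub>L 'a) \<Rightarrow> bool" where
  "power_bounded T \<longleftrightarrow> (\<exists>C. \<forall>n. norm (blinfun_pow T n) \<le> C)"

definition op_spectrum :: "('a::complex_normed_vector \<Rightarrow>\<^sub>L 'a) \<Rightarrow> complex set" where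
  "op_spectrum T = {z. \<not> (\<exists>R::'a \<Rightarrow>\<^sub>L 'a. clinear_op R \<and>
      (\<forall>x. blinfun_apply R (z *\<^sub>C x - blinfun_apply T x) = x) \<and>
      (\<forall>x. z *\<^sub>C blinfun_apply R x - blinfun_apply T (blinfun_apply R x) = x))}"

definition is_prob :: "(int \<Rightarrow> real) \<Rightarrow> bool" where
  "is_prob F \<longleftrightarrow> (\<forall>k. 0 \<le> F k \<and> F k \<le> 1) \<and> (F has_sum 1) UNIV"

definition is_prob_nonneg :: "(int \<Rightarrow> real) \<Rightarrow> bool" where
  "is_prob_nonneg F \<longleftrightarrow> is_prob F \<and> (\<forall>k<0. F k = 0)"

definition supp :: "(int \<Rightarrow> real) \<Rightarrow> int set" where
  "supp F = {k. F k \<noteq> 0}"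

definition generates_Z :: "int set \<Rightarrow> bool" where
  "generates_Z S \<longleftrightarrow> (\<forall>H. 0 \<in> H \<and> (\<forall>a\<in>H. \<forall>b\<in>H. a - b \<in> H) \<and> S \<subseteq> H \<longrightarrow> H = UNIV)"

definition adapted :: "(int \<Rightarrow> real) \<Rightarrow> bool" where
  "adapted F \<longleftrightarrow> generates_Z (supp F)"

definition delta :: "int \<Rightarrow> int \<Rightarrow> real" where
  "delta m k = (if k = m then 1 else 0)"

definition conv :: "(int \<Rightarrow> real) \<Rightarrow> (int \<Rightarrow> real) \<Rightarrow> int \<Rightarrow> real" (infixl \<open>\<star>\<close> 70) where
  "conv F G k = (\<Sum>\<^sub>\<infinity>j. F j * G (k - j))"

definition aperiodic :: "(int \<Rightarrow> real) \<Rightarrow> bool" where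
  "aperiodic F \<longleftrightarrow> (\<forall>m. adapted (delta m \<star> F))"

definition Psi :: "(int \<Rightarrow> real) \<Rightarrow> ('a::real_normed_vector \<Rightarrow>\<^sub>L 'a) \<Rightarrow> ('a \<Rightarrow>\<^sub>L 'a)" where
  "Psi F T = (\<Sum>k. F (int k) *\<^sub>R blinfun_pow T k)"

end

theory Submission
  imports Defs "HOL-Computational_Algebra.Polynomial"
begin

text \<open>
  The key is to write \<open>\<Psi>(F;T) = (1 - \<beta>) I + \<beta> S\<close> with \<open>0 < \<beta> < 1\<close> and \<open>S\<close> power-bounded. Then
  \<open>\<Psi>\<^sup>n - \<Psi>\<^sup>n\<^sup>+\<^sup>1\<close> is a polynomial in \<open>S\<close> whose coefficients are differences of binomial
  probabilities. Their absolute sum is a constant times the mean absolute deviation of the binomial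
  distribution divided by \<open>n\<close>, hence \<open>O(1 / sqrt n)\<close>. The Neumann series for \<open>S\<close> gives the spectral
  inclusion.

  To find \<open>S\<close>, split \<open>F\<close> into its restriction to \<open>{0..L}\<close>, of mass \<open>\<alpha>\<close>, and a tail. The tail gives an
  operator \<open>B\<close> with \<open>\<parallel>B\<^sup>n\<parallel> = O((1 - \<alpha>)\<^sup>n)\<close>. If \<open>L\<close> is large, aperiodicity gives
  \<open>\<alpha>\<^sup>2 - |f(t)|\<^sup>2 \<ge> c (1 - cos t)\<close> for the Fourier transform \<open>f\<close> of the restriction, so
  that for small \<open>\<gamma>\<close> the trigonometric polynomial \<open>(f - \<alpha>\<gamma>) / (\<alpha>(1 - \<gamma>))\<close> is still dominated by a
  Gaussian on \<open>[-\<pi>, \<pi>]\<close>; by Parseval and Cauchy-Schwarz its powers have bounded coefficient sums.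
  Hence the restriction minus \<open>\<alpha>\<gamma> I\<close> gives \<open>A\<close> with \<open>\<parallel>A\<^sup>n\<parallel> = O((\<alpha>(1 - \<gamma>))\<^sup>n)\<close>, and, as \<open>A\<close>
  and \<open>B\<close> commute, \<open>\<parallel>(A + B)\<^sup>n\<parallel> = O(\<beta>\<^sup>n)\<close> with \<open>\<beta> = 1 - \<alpha>\<gamma>\<close>.
\<close>

subsection \<open>Powers of polynomials dominated by a Gaussian on the circle\<close>

lemma has_integral_cis_int:
  "((\<lambda>t. cis (of_int m * t)) has_integral (if m = 0 then of_real (2 * pi) else 0)) {-pi..pi}"
proof -
  have "((\<lambda>t. complex_of_real (cos (of_int m * t)) + \<i> * of_real (sin (of_int m * t)))
      has_integral (of_real (if m = 0 then 2 * pi else 0) + \<i> * of_real 0)) {-pi..pi}"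
    by (intro has_integral_add has_integral_mult_right has_integral_of_real
        has_integral_cos_nx has_integral_sin_nx)
  then show ?thesis
    by (cases "m = 0") (simp_all add: cis_conv_exp exp_Euler flip: cos_of_real sin_of_real of_real_mult)
qed

lemma cmod_poly_cis_sq:
  fixes q :: "complex poly"
  shows "of_real ((cmod (poly q (cis t)))\<^sup>2) =
    (\<Sum>j\<le>degree q. \<Sum>k\<le>degree q. coeff q j * cnj (coeff q k) * cis (of_int (int j - int k) * t))"
proof -
  have "of_real ((cmod (poly q (cis t)))\<^sup>2) = poly q (cis t) * cnj (poly q (cis t))"
    by (rule complex_norm_square)
  also have "\<dots> = (\<Sum>j\<le>degree q. \<Sum>k\<le>degree q.
      (coeff q j * cis t ^ j) * cnj (coeff q k * cis t ^ k))"
    by (simp add: poly_altdef sum_product cnj_sum)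
  also have "\<dots> = (\<Sum>j\<le>degree q. \<Sum>k\<le>degree q. coeff q j * cnj (coeff q k) * cis (of_int (int j - int k) * t))"
    by (intro sum.cong refl)
      (simp add: Complex.DeMoivre cis_cnj cis_mult left_diff_distrib mult.assoc mult.left_commute)
  finally show ?thesis .
qed

lemma parseval_poly:
  fixes q :: "complex poly"
  shows "((\<lambda>t. (cmod (poly q (cis t)))\<^sup>2) has_integral
    2 * pi * (\<Sum>k\<le>degree q. (cmod (coeff q k))\<^sup>2)) {-pi..pi}"
proof -
  have "((\<lambda>t. \<Sum>j\<le>degree q. \<Sum>k\<le>degree q. coeff q j * cnj (coeff q k) * cis (of_int (int j - int k) * t))
    has_integral (\<Sum>j\<le>degree q. \<Sum>k\<le>degree q. coeff q j * cnj (coeff q k) *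
      (if int j - int k = 0 then of_real (2 * pi) else 0))) {-pi..pi}"
    by (intro has_integral_sum has_integral_mult_right has_integral_cis_int finite_atMost)
  moreover have "(\<Sum>j\<le>degree q. \<Sum>k\<le>degree q. coeff q j * cnj (coeff q k) *
      (if int j - int k = 0 then of_real (2 * pi) else 0)) =
      of_real (2 * pi * (\<Sum>k\<le>degree q. (cmod (coeff q k))\<^sup>2))"
    by (simp add: if_distrib [of "(*) _"] complex_norm_square sum_distrib_left mult_ac cong: if_cong)
      (simp flip: complex_norm_square)
  ultimately have "((\<lambda>t. complex_of_real ((cmod (poly q (cis t)))\<^sup>2)) has_integral
      of_real (2 * pi * (\<Sum>k\<le>degree q. (cmod (coeff q k))\<^sup>2))) {-pi..pi}"
    by (simp only: cmod_poly_cis_sq)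
  from has_integral_linear [OF this bounded_linear_Re] show ?thesis
    by (simp add: o_def)
qed

text \<open>The antiderivative is \<open>arctan (sqrt a * t) / sqrt a\<close>. This rational kernel
  stands in for the Gaussian: it has the same scaling in \<open>a\<close> and an elementary
  integral.\<close>

lemma integral_inverse_quadratic_le:
  assumes "a > 0"
  shows "(\<lambda>t::real. 1 / (1 + a * t\<^sup>2)) integrable_on {-pi..pi}"
    and "integral {-pi..pi} (\<lambda>t. 1 / (1 + a * t\<^sup>2)) \<le> pi / sqrt a"
proof -
  let ?s = "sqrt a"
  have "((\<lambda>t. 1 / (1 + a * t\<^sup>2)) has_integral
      (arctan (?s * pi) / ?s - arctan (?s * (-pi)) / ?s)) {-pi..pi}"
  proof (rule fundamental_theorem_of_calculus)
    fix x :: real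
    have "((\<lambda>t. arctan (?s * t)) has_real_derivative
        inverse (1 + (?s * x)\<^sup>2) * ?s) (at x within {-pi..pi})"
      by (auto intro!: derivative_eq_intros)
    then have "((\<lambda>t. arctan (?s * t) / ?s) has_real_derivative
        inverse (1 + (?s * x)\<^sup>2) * ?s / ?s) (at x within {-pi..pi})"
      by (rule DERIV_cdivide)
    moreover have "inverse (1 + (?s * x)\<^sup>2) * ?s / ?s = 1 / (1 + a * x\<^sup>2)"
      using assms by (simp add: power_mult_distrib inverse_eq_divide)
    ultimately show "((\<lambda>t. arctan (?s * t) / ?s) has_vector_derivative 1 / (1 + a * x\<^sup>2))
        (at x within {-pi..pi})"
      by (simp add: has_real_derivative_iff_has_vector_derivative)
  qed simp
  moreover have "arctan (?s * pi) / ?s - arctan (?s * (-pi)) / ?s \<le> pi / ?s"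
    using arctan_ubound [of "?s * pi"] assms
    by (simp add: arctan_minus field_simps)
  ultimately show "(\<lambda>t::real. 1 / (1 + a * t\<^sup>2)) integrable_on {-pi..pi}"
    "integral {-pi..pi} (\<lambda>t. 1 / (1 + a * t\<^sup>2)) \<le> pi / sqrt a"
    by (auto simp: integral_unique has_integral_integrable)
qed

text \<open>Each term is compared with the increment of \<open>arctan (t * _)\<close> over an
  interval of length 1; the increments telescope to at most \<open>pi\<close>.\<close>

lemma sum_inverse_quadratic_le:
  fixes t x :: real
  assumes "0 < t" "t \<le> 1"
  shows "(\<Sum>k\<le>N. 1 / (1 + t\<^sup>2 * (real k - x)\<^sup>2)) \<le> 3 * pi / t"
proof -
  define f where "f k = arctan (t * (real k - x))" for k
  have step: "1 / (1 + t\<^sup>2 * (real k - x)\<^sup>2) \<le> 3 / t * (f (Suc k) - f k)" for k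
  proof -
    let ?a = "real k - x"
    have "\<exists>z. ?a < z \<and> z < ?a + 1 \<and> arctan (t * (?a + 1)) - arctan (t * ?a)
        = (?a + 1 - ?a) * (inverse (1 + (t * z)\<^sup>2) * t)"
      by (rule MVT2) (auto intro!: derivative_eq_intros)
    then obtain z where z: "?a < z" "z < ?a + 1"
      "f (Suc k) - f k = inverse (1 + (t * z)\<^sup>2) * t"
      by (auto simp: f_def algebra_simps)
    \<comment> \<open>Moving by at most 1 from \<open>?a\<close> to the mean value point
      \<open>z\<close> changes the denominator by a factor of at most 3, because
      \<open>t \<le> 1\<close>. This is the origin of the constant 3.\<close>
    have "z\<^sup>2 = (?a + (z - ?a))\<^sup>2" by simp
    also have "\<dots> \<le> 2 * ?a\<^sup>2 + 2 * (z - ?a)\<^sup>2"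
      using sum_squares_ge_zero [of "?a - (z - ?a)" 0] by (simp add: power2_eq_square algebra_simps)
    also have "(z - ?a)\<^sup>2 \<le> 1"
      using z by (simp add: power_le_one)
    finally have "t\<^sup>2 * z\<^sup>2 \<le> t\<^sup>2 * (2 * ?a\<^sup>2 + 2)"
      by (intro mult_left_mono) auto
    moreover have "t\<^sup>2 \<le> 1"
      using assms by (simp add: power_le_one)
    ultimately have le: "1 + (t * z)\<^sup>2 \<le> 3 * (1 + t\<^sup>2 * ?a\<^sup>2)"
      by (simp add: power_mult_distrib algebra_simps) (smt (verit) zero_le_power2 mult_nonneg_nonneg)
    have pos: "0 < 1 + t\<^sup>2 * ?a\<^sup>2" "0 < 1 + (t * z)\<^sup>2"
      by (auto intro!: add_pos_nonneg)
    have "3 / t * (f (Suc k) - f k) = 3 / (1 + (t * z)\<^sup>2)"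
      using assms z(3) by (simp add: field_simps)
    with le pos show ?thesis
      by (simp add: frac_le divide_le_eq pos_le_divide_eq mult.commute)
  qed
  have "(\<Sum>k\<le>N. 1 / (1 + t\<^sup>2 * (real k - x)\<^sup>2)) \<le> (\<Sum>k\<le>N. 3 / t * (f (Suc k) - f k))"
    by (intro sum_mono step)
  also have "\<dots> = 3 / t * (f (Suc N) - f 0)"
    using sum_lessThan_telescope [of f "Suc N"]
    by (simp only: lessThan_Suc_atMost flip: sum_distrib_left)
  also have "\<dots> \<le> 3 / t * pi"
    using arctan_ubound [of "t * (real (Suc N) - x)"] arctan_lbound [of "t * (real 0 - x)"] assms
    by (intro mult_left_mono) (auto simp: f_def)
  finally show ?thesis by simp
qed

text \<open>Cauchy-Schwarz with the weights \<open>1 + t\<^sup>2 * (real k - x)\<^sup>2\<close>,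
  whose reciprocals have sum at most \<open>3 * pi / t\<close>. For a sequence concentrated within
  distance \<open>1 / t\<close> of \<open>x\<close> this passes from l2 to l1 without essential
  loss.\<close>

lemma sum_abs_le_weighted_l2:
  fixes a :: "nat \<Rightarrow> complex" and t x :: real
  assumes "0 < t" "t \<le> 1"
  shows "(\<Sum>k\<le>N. cmod (a k))\<^sup>2 \<le>
    3 * pi / t * ((\<Sum>k\<le>N. (cmod (a k))\<^sup>2) + t\<^sup>2 * (\<Sum>k\<le>N. (real k - x)\<^sup>2 * (cmod (a k))\<^sup>2))"
proof -
  define w where "w k = 1 + t\<^sup>2 * (real k - x)\<^sup>2" for k
  have w: "w k > 0" for k
    by (auto simp: w_def intro!: add_pos_nonneg)
  have "(\<Sum>k\<le>N. cmod (a k))\<^sup>2 = (\<Sum>k\<le>N. (1 / sqrt (w k)) * (sqrt (w k) * cmod (a k)))\<^sup>2"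
    using w by (simp add: less_imp_neq [OF w, symmetric])
  also have "\<dots> \<le> (\<Sum>k\<le>N. (1 / sqrt (w k))\<^sup>2) * (\<Sum>k\<le>N. (sqrt (w k) * cmod (a k))\<^sup>2)"
    by (rule Cauchy_Schwarz_ineq_sum)
  also have "\<dots> = (\<Sum>k\<le>N. 1 / w k) * (\<Sum>k\<le>N. w k * (cmod (a k))\<^sup>2)"
    using w by (simp add: power_divide power_mult_distrib less_imp_le)
  also have "\<dots> \<le> 3 * pi / t * (\<Sum>k\<le>N. w k * (cmod (a k))\<^sup>2)"
    using sum_inverse_quadratic_le [OF assms, of x N] w
    by (intro mult_right_mono sum_nonneg) (auto simp: w_def less_imp_le)
  also have "(\<Sum>k\<le>N. w k * (cmod (a k))\<^sup>2) =
      (\<Sum>k\<le>N. (cmod (a k))\<^sup>2) + t\<^sup>2 * (\<Sum>k\<le>N. (real k - x)\<^sup>2 * (cmod (a k))\<^sup>2)"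
    by (simp add: w_def sum.distrib sum_distrib_left algebra_simps)
  finally show ?thesis .
qed

section \<open>Elementary estimates for polynomials on the disc, \<open>cis\<close> and
  \<open>exp\<close>\<close>

lemma cmod_poly_le_sum_coeffs:
  fixes p :: "complex poly"
  assumes "cmod z \<le> 1"
  shows "cmod (poly p z) \<le> (\<Sum>k\<le>degree p. cmod (coeff p k))"
proof -
  have "cmod (poly p z) \<le> (\<Sum>k\<le>degree p. cmod (coeff p k * z ^ k))"
    unfolding poly_altdef by (rule norm_sum)
  also have "\<dots> \<le> (\<Sum>k\<le>degree p. cmod (coeff p k))"
    using assms by (intro sum_mono) (simp add: norm_mult norm_power mult_left_le power_le_one)
  finally show ?thesis .
qed

lemma cmod_cis_minus_1: "cmod (cis t - 1) \<le> \<bar>t\<bar>"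
proof -
  have "cmod (cis t - 1) = 2 * \<bar>sin (t / 2)\<bar>"
    by (simp add: cis_conv_exp dist_exp_i_1)
  also have "\<dots> \<le> 2 * \<bar>t / 2\<bar>"
    using abs_sin_x_le_abs_x [of "t / 2"] by simp
  finally show ?thesis by simp
qed

text \<open>Lower Taylor bounds for \<open>exp y\<close> of order 1 and 2. They replace Gaussians by
  the rational kernel integrated above.\<close>

lemma exp_minus_le_inverse:
  fixes y :: real
  assumes "0 \<le> y"
  shows "exp (- y) \<le> 1 / (1 + y)" "y * exp (- y) \<le> 2 / (1 + y)"
proof -
  show "exp (- y) \<le> 1 / (1 + y)"
    using assms exp_ge_add_one_self [of y] by (simp add: exp_minus field_simps)
  have "y * (1 + y) \<le> 2 * exp y"
    using exp_lower_Taylor_quadratic [OF assms] assms by (simp add: power2_eq_square algebra_simps)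
  then show "y * exp (- y) \<le> 2 / (1 + y)"
    using assms by (simp add: exp_minus field_simps)
qed

text \<open>Parseval turns the pointwise bound into an l2 bound for the coefficients, and the
  integral of the rational kernel supplies the factor \<open>1 / sqrt a\<close>.\<close>

lemma sum_coeffs_sq_le:
  fixes q :: "complex poly"
  assumes "a > 0" and "0 \<le> K"
    and bound: "\<And>t. \<bar>t\<bar> \<le> pi \<Longrightarrow> (cmod (poly q (cis t)))\<^sup>2 \<le> K / (1 + a * t\<^sup>2)"
    and "degree q \<le> N"
  shows "(\<Sum>k\<le>N. (cmod (coeff q k))\<^sup>2) \<le> K / (2 * sqrt a)"
proof -
  have "2 * pi * (\<Sum>k\<le>degree q. (cmod (coeff q k))\<^sup>2) =
      integral {-pi..pi} (\<lambda>t. (cmod (poly q (cis t)))\<^sup>2)"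
    by (rule integral_unique [OF parseval_poly, symmetric])
  also have "\<dots> \<le> integral {-pi..pi} (\<lambda>t. K * (1 / (1 + a * t\<^sup>2)))"
    using bound integral_inverse_quadratic_le(1) [OF \<open>a > 0\<close>]
    by (intro integral_le integrable_on_mult_right has_integral_integrable [OF parseval_poly])
      (auto simp: abs_le_iff)
  also have "\<dots> \<le> K * (pi / sqrt a)"
    using integral_inverse_quadratic_le(2) [OF \<open>a > 0\<close>] \<open>0 \<le> K\<close>
    by (simp only: integral_mult_right mult_left_mono)
  finally have "(\<Sum>k\<le>degree q. (cmod (coeff q k))\<^sup>2) \<le> K / (2 * sqrt a)"
    using \<open>a > 0\<close> by (simp add: field_simps)
  moreover have "(\<Sum>k\<le>N. (cmod (coeff q k))\<^sup>2) = (\<Sum>k\<le>degree q. (cmod (coeff q k))\<^sup>2)"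
    using \<open>degree q \<le> N\<close> by (intro sum.mono_neutral_right) (auto simp: coeff_eq_0)
  ultimately show ?thesis by simp
qed

text \<open>By Parseval the squared l2 norm of the coefficients of \<open>G ^ n\<close> is of order
  \<open>1 / sqrt n\<close>, and that of the coefficients weighted by their distance from
  \<open>n * \<mu>\<close> is of order \<open>sqrt n\<close>. The weighted Cauchy-Schwarz inequality
  at width \<open>sqrt n\<close> makes the two contributions bounded.\<close>

lemma power_coeffs_l1_bounded:
  fixes G :: "complex poly"
  assumes G1: "poly G 1 = 1" and c: "c > 0"
    and bound: "\<And>t. \<bar>t\<bar> \<le> pi \<Longrightarrow> (cmod (poly G (cis t)))\<^sup>2 \<le> exp (- c * t\<^sup>2)"
  shows "\<exists>C. \<forall>n. (\<Sum>k\<le>degree (G ^ n). cmod (coeff (G ^ n) k)) \<le> C"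
proof -
  define \<mu> where "\<mu> = poly (pderiv G) 1"
  \<comment> \<open>\<open>h\<close> is \<open>z G'(z) - \<mu> G(z)\<close>. Subtracting the mean
    \<open>\<mu>\<close> creates a zero at 1, hence a factor \<open>z - 1\<close> and a bound
    proportional to \<open>\<bar>t\<bar>\<close> on the circle.\<close>
  define h where "h = pCons 0 (pderiv G) - smult \<mu> G"
  have "poly h 1 = 0"
    by (simp add: h_def \<mu>_def G1)
  then obtain h' where h': "h = [:-1, 1:] * h'"
    by (auto simp: poly_eq_0_iff_dvd)
  define K where "K = (\<Sum>k\<le>degree h'. cmod (coeff h' k))"
  have K: "0 \<le> K"
    by (simp add: K_def sum_nonneg)
  have h_le: "(cmod (poly h (cis t)))\<^sup>2 \<le> t\<^sup>2 * K\<^sup>2" for t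
  proof -
    have "cmod (poly h (cis t)) = cmod (cis t - 1) * cmod (poly h' (cis t))"
      by (simp add: h' flip: norm_mult) (simp add: algebra_simps)
    also have "\<dots> \<le> \<bar>t\<bar> * K"
      unfolding K_def
      by (intro mult_mono cmod_cis_minus_1 cmod_poly_le_sum_coeffs) auto
    finally have "(cmod (poly h (cis t)))\<^sup>2 \<le> (\<bar>t\<bar> * K)\<^sup>2"
      by (intro power_mono) auto
    then show ?thesis
      by (simp add: power_mult_distrib)
  qed
  \<comment> \<open>The factor \<open>exp (c * pi\<^sup>2)\<close> compensates for the exponent
    \<open>n - 1\<close> in place of \<open>n\<close> in the derivative of \<open>G ^ n\<close>; 2
    comes from the bound on \<open>y * exp (- y)\<close>.\<close>
  define K2 where "K2 = 2 * K\<^sup>2 * exp (c * pi\<^sup>2) / c"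
  have K2: "0 \<le> K2"
    using c by (simp add: K2_def)
  \<comment> \<open>The value 1 serves the case \<open>n = 0\<close>, where \<open>G ^ 0\<close> has
    coefficient sum 1.\<close>
  define C where "C = max 1 (sqrt (3 * pi * (1 + K2) / (2 * sqrt c)))"
  have "(\<Sum>k\<le>degree (G ^ n). cmod (coeff (G ^ n) k)) \<le> C" for n
  proof (cases "n = 0")
    case True
    then show ?thesis by (simp add: C_def)
  next
    case False
    define q where "q = G ^ n"
    define N where "N = degree q"
    define a where "a = c * real n"
    \<comment> \<open>\<open>R\<close> weights the \<open>k\<close>-th coefficient of \<open>G\<^sup>n\<close> by \<open>k - n \<mu>\<close>, the deviation from the mean,
      and equals \<open>n G\<^sup>n\<^sup>-\<^sup>1 h\<close>, where \<open>h\<close> vanishes at \<open>1\<close>.\<close>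
    define R where "R = pCons 0 (pderiv q) - smult (of_nat n * \<mu>) q"
    have n: "real n \<ge> 1" and a: "a > 0"
      using False c by (auto simp: a_def)
    have q_le: "(cmod (poly q (cis t)))\<^sup>2 \<le> exp (- (a * t\<^sup>2))" if "\<bar>t\<bar> \<le> pi" for t
    proof -
      have "(cmod (poly q (cis t)))\<^sup>2 = ((cmod (poly G (cis t)))\<^sup>2) ^ n"
        by (simp add: q_def poly_power norm_power flip: power_mult) (simp add: mult.commute)
      also have "\<dots> \<le> exp (- c * t\<^sup>2) ^ n"
        using bound [OF that] by (intro power_mono) auto
      finally show ?thesis
        by (simp add: a_def mult_ac flip: exp_of_nat_mult)
    qed
    have 1: "(\<Sum>k\<le>N. (cmod (coeff q k))\<^sup>2) \<le> 1 / (2 * sqrt a)"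
    proof (rule sum_coeffs_sq_le)
      show "(cmod (poly q (cis t)))\<^sup>2 \<le> 1 / (1 + a * t\<^sup>2)" if "\<bar>t\<bar> \<le> pi" for t
        using q_le [OF that] exp_minus_le_inverse(1) [of "a * t\<^sup>2"] a by simp
    qed (use a in \<open>auto simp: N_def\<close>)
    have coeff_R: "coeff R k = (of_nat k - of_nat n * \<mu>) * coeff q k" for k
      by (cases k) (auto simp: R_def coeff_pderiv algebra_simps)
    have R: "poly R z = of_nat n * poly G z ^ (n - 1) * poly h z" for z
    proof -
      obtain m where "n = Suc m"
        using False by (cases n) auto
      then show ?thesis
        by (simp add: R_def h_def q_def pderiv_power_Suc poly_power del: of_nat_Suc power_Suc)
          (simp add: algebra_simps)
    qed
    have 2: "(\<Sum>k\<le>N. (cmod (coeff R k))\<^sup>2) \<le> (real n * K2) / (2 * sqrt a)"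
    proof (rule sum_coeffs_sq_le)
      show "(cmod (poly R (cis t)))\<^sup>2 \<le> real n * K2 / (1 + a * t\<^sup>2)" if t: "\<bar>t\<bar> \<le> pi" for t
      proof -
        have "(cmod (poly R (cis t)))\<^sup>2 =
            (real n)\<^sup>2 * ((cmod (poly G (cis t)))\<^sup>2) ^ (n - 1) * (cmod (poly h (cis t)))\<^sup>2"
          by (simp add: R norm_mult norm_power power_mult_distrib flip: power_mult) (simp add: mult.commute)
        also have "\<dots> \<le> (real n)\<^sup>2 * exp (- c * t\<^sup>2) ^ (n - 1) * (t\<^sup>2 * K\<^sup>2)"
          using bound [OF t] h_le [of t] by (intro mult_mono power_mono) auto
        also have "exp (- c * t\<^sup>2) ^ (n - 1) = exp (c * t\<^sup>2) * exp (- (a * t\<^sup>2))"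
          using False by (simp add: a_def of_nat_diff algebra_simps flip: exp_of_nat_mult exp_add)
        also have "(real n)\<^sup>2 * (exp (c * t\<^sup>2) * exp (- (a * t\<^sup>2))) * (t\<^sup>2 * K\<^sup>2) =
            real n * K\<^sup>2 / c * exp (c * t\<^sup>2) * (a * t\<^sup>2 * exp (- (a * t\<^sup>2)))"
          using c by (simp add: a_def power2_eq_square)
        also have "\<dots> \<le> real n * K\<^sup>2 / c * exp (c * pi\<^sup>2) * (2 / (1 + a * t\<^sup>2))"
          using c a exp_minus_le_inverse(2) [of "a * t\<^sup>2"] t power_mono [OF t, of 2]
          by (intro mult_mono) auto
        also have "\<dots> = real n * K2 / (1 + a * t\<^sup>2)"
          by (simp add: K2_def)
        finally show ?thesis .
      qed
      show "degree R \<le> N"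
        using coeff_R by (intro degree_le) (auto simp: N_def coeff_eq_0)
    qed (use a K2 in auto)
    \<comment> \<open>This scale balances the two terms: \<open>s\<^sup>2\<close> cancels the factor
      \<open>real n\<close> in the second l2 bound, and \<open>1 / s\<close> cancels
      \<open>1 / sqrt (real n)\<close> from \<open>1 / sqrt a\<close>.\<close>
    define s where "s = 1 / sqrt (real n)"
    have s: "0 < s" "s \<le> 1" "s\<^sup>2 = 1 / real n"
      using n by (auto simp: s_def power_divide)
    \<comment> \<open>\<open>\<mu>\<close> is a complex number, while the weights need a real
      centre; passing to \<open>Re \<mu>\<close> only shrinks the deviations.\<close>
    have 3: "(\<Sum>k\<le>N. (real k - real n * Re \<mu>)\<^sup>2 * (cmod (coeff q k))\<^sup>2) \<le> (\<Sum>k\<le>N. (cmod (coeff R k))\<^sup>2)"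
    proof (rule sum_mono)
      fix k
      have "(real k - real n * Re \<mu>)\<^sup>2 \<le> (cmod (of_nat k - of_nat n * \<mu>))\<^sup>2"
        using abs_Re_le_cmod [of "of_nat k - of_nat n * \<mu>"] by (simp add: power2_le_iff_abs_le)
      then show "(real k - real n * Re \<mu>)\<^sup>2 * (cmod (coeff q k))\<^sup>2 \<le> (cmod (coeff R k))\<^sup>2"
        by (simp add: coeff_R norm_mult power_mult_distrib mult_right_mono)
    qed
    have "(\<Sum>k\<le>N. cmod (coeff q k))\<^sup>2 \<le> 3 * pi / s * ((\<Sum>k\<le>N. (cmod (coeff q k))\<^sup>2) +
        s\<^sup>2 * (\<Sum>k\<le>N. (real k - real n * Re \<mu>)\<^sup>2 * (cmod (coeff q k))\<^sup>2))"
      by (rule sum_abs_le_weighted_l2) (use s in auto)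
    also have "\<dots> \<le> 3 * pi / s * (1 / (2 * sqrt a) + s\<^sup>2 * ((real n * K2) / (2 * sqrt a)))"
      using 1 2 3 s(1) by (intro mult_left_mono add_mono) auto
    also have "\<dots> = 3 * pi * (1 + K2) / (2 * sqrt c)"
      using n c s(3) by (simp add: s_def a_def real_sqrt_mult field_simps)
    finally have "(\<Sum>k\<le>N. cmod (coeff q k)) \<le> sqrt (3 * pi * (1 + K2) / (2 * sqrt c))"
      by (rule real_le_rsqrt)
    then show ?thesis
      by (simp add: C_def q_def N_def)
  qed
  then show ?thesis by blast
qed

subsection \<open>Aperiodic distributions\<close>

lemma conv_delta: "(delta m \<star> F) k = F (k - m)"
proof -
  have "(\<Sum>\<^sub>\<infinity>j. delta m j * F (k - j)) = (\<Sum>\<^sub>\<infinity>j\<in>{m}. delta m j * F (k - j))"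
    by (rule infsum_cong_neutral) (auto simp: delta_def)
  then show ?thesis
    by (simp add: conv_def delta_def)
qed

section \<open>Inequalities for \<open>1 - cos\<close>\<close>

lemma one_minus_cos: "1 - cos x = 2 * (sin (x / 2))\<^sup>2" for x :: real
  using cos_double_sin [of "x / 2"] by simp

text \<open>In terms of half angles, \<open>\<bar>sin\<bar>\<close> is subadditive; squaring the sum
  costs the factor 2.\<close>

lemma one_minus_cos_diff_le:
  fixes x y :: real
  shows "1 - cos (x - y) \<le> 2 * (1 - cos x) + 2 * (1 - cos y)"
proof -
  define u v where "u = x / 2" and "v = y / 2"
  have "\<bar>sin (u - v)\<bar> \<le> \<bar>sin u * cos v\<bar> + \<bar>cos u * sin v\<bar>"
    unfolding sin_diff by (rule abs_triangle_ineq4)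
  also have "\<dots> \<le> \<bar>sin u\<bar> + \<bar>sin v\<bar>"
    by (intro add_mono) (simp_all add: abs_mult mult_left_le mult_left_le_one_le)
  finally have "(sin (u - v))\<^sup>2 \<le> (\<bar>sin u\<bar> + \<bar>sin v\<bar>)\<^sup>2"
    by (metis abs_ge_zero power2_abs power_mono)
  also have "\<dots> \<le> 2 * (sin u)\<^sup>2 + 2 * (sin v)\<^sup>2"
    using zero_le_power2 [of "\<bar>sin u\<bar> - \<bar>sin v\<bar>"] by (simp add: power2_sum power2_diff)
  finally show ?thesis
    by (simp add: one_minus_cos u_def v_def diff_divide_distrib)
qed

lemma one_minus_cos_mult_le:
  fixes x :: real
  shows "1 - cos (real k * x) \<le> (real k)\<^sup>2 * (1 - cos x)"
proof -
  have "\<bar>sin (real k * y)\<bar> \<le> real k * \<bar>sin y\<bar>" for y :: real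
  proof (induction k)
    case (Suc k)
    have "\<bar>sin (real (Suc k) * y)\<bar> \<le> \<bar>sin (real k * y) * cos y\<bar> + \<bar>cos (real k * y) * sin y\<bar>"
      by (simp add: distrib_right sin_add add.commute [of 1])
    also have "\<dots> \<le> \<bar>sin (real k * y)\<bar> + \<bar>sin y\<bar>"
      by (intro add_mono) (simp_all add: abs_mult mult_left_le mult_left_le_one_le)
    finally show ?case
      using Suc by (simp add: algebra_simps)
  qed simp
  from power_mono [OF this [of "x / 2"], of 2] show ?thesis
    by (simp add: one_minus_cos power_mult_distrib)
qed

text \<open>With \<open>y = \<bar>x\<bar> / 4\<close> in \<open>[0, pi / 4]\<close> one has
  \<open>y \<le> tan y\<close> and \<open>cos y ^ 2 \<ge> 1 / 2\<close>, so
  \<open>sin (\<bar>x\<bar> / 2) = 2 * sin y * cos y \<ge> y\<close>.\<close>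

lemma one_minus_cos_ge:
  fixes x :: real
  assumes "\<bar>x\<bar> \<le> pi"
  shows "x\<^sup>2 / 8 \<le> 1 - cos x"
proof -
  define y where "y = \<bar>x\<bar> / 4"
  have y: "0 \<le> y" "y \<le> pi / 4"
    using assms by (auto simp: y_def)
  have c: "sqrt 2 / 2 \<le> cos y"
    using y cos_monotone_0_pi_le [of y "pi / 4"] by (simp add: cos_45)
  have s: "y / 2 \<le> sin y * cos y"
  proof (cases "y = 0")
    case False
    have "\<exists>z. 0 < z \<and> z < y \<and> tan y - tan 0 = (y - 0) * inverse ((cos z)\<^sup>2)"
    proof (rule MVT2)
      fix z assume "0 \<le> z" "z \<le> y"
      then have "cos z > 0" using y pi_gt_zero by (intro cos_gt_zero_pi) (linarith+)
      then show "(tan has_real_derivative inverse ((cos z)\<^sup>2)) (at z)"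
        by (intro DERIV_tan) auto
    qed (use False y in auto)
    then obtain z where z: "0 < z" "z < y" "tan y = y * inverse ((cos z)\<^sup>2)"
      by auto
    have "0 < cos z" using y z pi_gt_zero by (intro cos_gt_zero_pi) (linarith+)
    then have "1 \<le> inverse ((cos z)\<^sup>2)"
      by (simp add: one_le_inverse_iff power_le_one)
    then have "y \<le> tan y"
      using y z by (simp add: mult_le_cancel_left1)
    then have "y * (cos y)\<^sup>2 \<le> tan y * (cos y)\<^sup>2"
      by (rule mult_right_mono) simp
    also have "\<dots> = sin y * cos y"
      using c by (simp add: tan_def power2_eq_square)
    finally have "y * (cos y)\<^sup>2 \<le> sin y * cos y" .
    moreover have "(sqrt 2 / 2)\<^sup>2 \<le> (cos y)\<^sup>2"
      using c by (intro power_mono) auto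
    then have "y * (1 / 2) \<le> y * (cos y)\<^sup>2"
      using y by (intro mult_left_mono) (auto simp: power_divide)
    ultimately show ?thesis by simp
  qed auto
  have "y \<le> sin (\<bar>x\<bar> / 2)"
    using s sin_double [of y] by (simp add: y_def)
  then have "y\<^sup>2 \<le> (sin (\<bar>x\<bar> / 2))\<^sup>2"
    using y by (intro power_mono) auto
  moreover have "(sin (\<bar>x\<bar> / 2))\<^sup>2 = (sin (x / 2))\<^sup>2"
    by (cases "x \<ge> 0") auto
  ultimately show ?thesis
    by (simp add: one_minus_cos y_def power_divide)
qed

text \<open>The squared mass of the truncation to \<open>{0..L}\<close> minus the squared modulus of
  its Fourier transform at \<open>t\<close>. As a double sum over pairs with nonnegative terms for
  \<open>F \<ge> 0\<close>, it is visibly monotone in \<open>L\<close> and bounded below by each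
  single pair.\<close>

definition sym_defect :: "(int \<Rightarrow> real) \<Rightarrow> nat \<Rightarrow> real \<Rightarrow> real" where
  "sym_defect F L t = (\<Sum>j\<le>L. \<Sum>k\<le>L. F (int j) * F (int k) * (1 - cos ((real j - real k) * t)))"

lemma sym_defect_mono:
  assumes "\<And>k. 0 \<le> F k" and "L \<le> M"
  shows "sym_defect F L t \<le> sym_defect F M t"
proof -
  have "sym_defect F L t \<le> (\<Sum>j\<le>L. \<Sum>k\<le>M. F (int j) * F (int k) * (1 - cos ((real j - real k) * t)))"
    unfolding sym_defect_def using assms by (intro sum_mono sum_mono2) auto
  also have "\<dots> \<le> sym_defect F M t"
    unfolding sym_defect_def using assms by (intro sum_mono2 sum_nonneg) auto
  finally show ?thesis .
qed

lemma sym_defect_ge_term: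
  assumes "\<And>k. 0 \<le> F k" and "j \<le> L" "k \<le> L"
  shows "F (int j) * F (int k) * (1 - cos ((real j - real k) * t)) \<le> sym_defect F L t"
proof -
  have "F (int j) * F (int k) * (1 - cos ((real j - real k) * t))
      \<le> (\<Sum>k\<le>L. F (int j) * F (int k) * (1 - cos ((real j - real k) * t)))"
    using assms
    by (intro member_le_sum [where f = "\<lambda>k. F (int j) * F (int k) * (1 - cos ((real j - real k) * t))"]) auto
  also have "\<dots> \<le> sym_defect F L t"
    unfolding sym_defect_def using assms
    by (intro member_le_sum [where f = "\<lambda>j. \<Sum>k\<le>L. F (int j) * F (int k) * (1 - cos ((real j - real k) * t))"]
        sum_nonneg) auto
  finally show ?thesis .
qed

lemma sym_defect_nonneg: "(\<And>k. 0 \<le> F k) \<Longrightarrow> 0 \<le> sym_defect F L t"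
  unfolding sym_defect_def by (intro sum_nonneg) auto

lemma sym_defect_eq:
  "sym_defect F L t = (\<Sum>k\<le>L. F (int k))\<^sup>2 - (cmod (\<Sum>k\<le>L. of_real (F (int k)) * cis t ^ k))\<^sup>2"
proof -
  let ?f = "\<Sum>k\<le>L. of_real (F (int k)) * cis t ^ k"
  have "Re ?f = (\<Sum>k\<le>L. F (int k) * cos (real k * t))" "Im ?f = (\<Sum>k\<le>L. F (int k) * sin (real k * t))"
    by (simp_all add: Complex.DeMoivre Re_sum Im_sum)
  then have "(cmod ?f)\<^sup>2 = (\<Sum>k\<le>L. F (int k) * cos (real k * t))\<^sup>2 + (\<Sum>k\<le>L. F (int k) * sin (real k * t))\<^sup>2"
    by (simp only: cmod_power2)
  also have "\<dots> = (\<Sum>j\<le>L. \<Sum>k\<le>L. F (int j) * F (int k) *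
      (cos (real j * t) * cos (real k * t) + sin (real j * t) * sin (real k * t)))"
    by (simp add: power2_eq_square sum_product distrib_left sum.distrib mult_ac)
  also have "\<dots> = (\<Sum>j\<le>L. \<Sum>k\<le>L. F (int j) * F (int k) * cos ((real j - real k) * t))"
    by (simp only: left_diff_distrib cos_diff)
  finally have "(cmod ?f)\<^sup>2 = (\<Sum>j\<le>L. \<Sum>k\<le>L. F (int j) * F (int k) * cos ((real j - real k) * t))" .
  then show ?thesis
    by (simp add: sym_defect_def power2_eq_square sum_product right_diff_distrib sum_subtractf)
qed

text \<open>A quantitative form of aperiodicity: one finite truncation already keeps its Fourier
  transform away from full modulus, to second order in \<open>t\<close> near 0 and uniformly
  elsewhere on the circle.\<close>

lemma aperiodic_sym_defect:
  assumes "is_prob_nonneg F" and "aperiodic F"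
  shows "\<exists>L C. 0 < C \<and> (\<forall>t. 1 - cos t \<le> C * sym_defect F L t)"
proof -
  have F: "\<And>k. 0 \<le> F k" "\<And>k. k < 0 \<Longrightarrow> F k = 0" and sum: "(F has_sum 1) UNIV"
    using assms(1) by (auto simp: is_prob_nonneg_def is_prob_def)
  obtain k0 where k0: "F k0 \<noteq> 0"
    using has_sum_unique [OF sum] has_sum_0 [of UNIV F] by force
  have k0': "0 \<le> k0"
    using k0 F(2) by force
  \<comment> \<open>Since \<open>1 - cos\<close> is subadditive up to a factor \<open>2\<close>, the frequencies controlled by some
    truncation form a subgroup; it contains all differences from \<open>k0\<close> of support points.\<close>
  define H where "H = {d::int. \<exists>L C. 0 \<le> C \<and> (\<forall>t. 1 - cos (of_int d * t) \<le> C * sym_defect F L t)}"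
  have "0 \<in> H"
    by (auto simp: H_def intro!: exI[of _ 0])
  moreover have "a - b \<in> H" if a: "a \<in> H" and b: "b \<in> H" for a b
  proof -
    from a obtain L C where L: "0 \<le> C" "\<And>t. 1 - cos (of_int a * t) \<le> C * sym_defect F L t"
      by (auto simp: H_def)
    from b obtain M D where M: "0 \<le> D" "\<And>t. 1 - cos (of_int b * t) \<le> D * sym_defect F M t"
      by (auto simp: H_def)
    define N where "N = max L M"
    have "1 - cos (of_int (a - b) * t) \<le> (2 * C + 2 * D) * sym_defect F N t" for t
    proof -
      have "1 - cos (of_int (a - b) * t) \<le> 2 * (1 - cos (of_int a * t)) + 2 * (1 - cos (of_int b * t))"
        using one_minus_cos_diff_le [of "of_int a * t" "of_int b * t"] by (simp add: left_diff_distrib)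
      also have "\<dots> \<le> 2 * (C * sym_defect F N t) + 2 * (D * sym_defect F N t)"
        using L M sym_defect_mono [of F L N t, OF F(1)] sym_defect_mono [of F M N t, OF F(1)]
        by (intro add_mono mult_left_mono order.trans [OF L(2)] order.trans [OF M(2)])
          (auto simp: N_def)
      finally show ?thesis by (simp add: algebra_simps)
    qed
    then show ?thesis
      using L(1) M(1) by (auto simp: H_def intro!: exI[of _ N] exI[of _ "2 * C + 2 * D"])
  qed
  moreover have "supp (delta (- k0) \<star> F) \<subseteq> H"
  proof
    fix d assume "d \<in> supp (delta (- k0) \<star> F)"
    then have d: "F (d + k0) \<noteq> 0"
      by (simp add: supp_def conv_delta)
    then have "0 \<le> d + k0"
      using F(2) by force
    define j k where "j = nat (d + k0)" and "k = nat k0"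
    have jk: "int j = d + k0" "int k = k0"
      using \<open>0 \<le> d + k0\<close> k0' by (auto simp: j_def k_def)
    then have djk: "real_of_int d = real j - real k"
      by (metis add_diff_cancel_right' of_int_diff of_int_of_nat_eq)
    have pos: "0 < F (int j) * F (int k)"
      using d k0 F(1) jk by (metis less_eq_real_def mult_pos_pos)
    have "1 - cos (of_int d * t) \<le> 1 / (F (int j) * F (int k)) * sym_defect F (max j k) t" for t
      using sym_defect_ge_term [of F j "max j k" k t, OF F(1)] pos
      by (simp add: djk pos_le_divide_eq mult.commute)
    then show "d \<in> H"
      using pos by (auto simp: H_def intro!: exI[of _ "max j k"] exI[of _ "1 / (F (int j) * F (int k))"])
  qed
  \<comment> \<open>Aperiodicity is applied to the translate by \<open>- k0\<close>, whose support
    consists of the differences from \<open>k0\<close>.\<close>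
  moreover have "generates_Z (supp (delta (- k0) \<star> F))"
    using assms(2) by (simp add: aperiodic_def adapted_def)
  ultimately have "H = UNIV"
    unfolding generates_Z_def by blast
  then have "1 \<in> H" by simp
  then obtain L C where L: "0 \<le> C" "\<And>t. 1 - cos t \<le> C * sym_defect F L t"
    by (auto simp: H_def)
  \<comment> \<open>Increasing \<open>C\<close> by 1 makes the constant strictly positive, so that
    it may be divided by.\<close>
  then have "1 - cos t \<le> (C + 1) * sym_defect F L t" for t
    using sym_defect_nonneg [of F L t, OF F(1)] L(2) [of t] unfolding distrib_right by linarith
  then show ?thesis
    using L(1) by (intro exI[of _ L] exI[of _ "C + 1"]) auto
qed

lemma map_poly_of_real_power:
  "map_poly of_real (p ^ n) = (map_poly of_real p ^ n :: 'a::{real_algebra_1,comm_ring_1} poly)"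
proof (induction n)
  case (Suc n)
  have "map_poly of_real (p * q) = (map_poly of_real p * map_poly of_real q :: 'a poly)" for q
    by (rule poly_eqI) (simp add: coeff_map_poly coeff_mult)
  then show ?case
    using Suc by simp
qed simp

text \<open>Subtracting \<open>\<alpha> * \<gamma>\<close> may make the constant coefficient
  negative, so positivity no longer controls the coefficient sums. The symmetric defect of the
  truncation pays for the subtraction and leaves a Gaussian bound for the normalised
  polynomial.\<close>

lemma truncation_power_coeffs_bounded:
  assumes "is_prob_nonneg F" and "aperiodic F"
  obtains L \<alpha> \<gamma> P C where "\<alpha> = (\<Sum>k\<le>L. F (int k))" "0 < \<alpha>" "0 < \<gamma>" "\<gamma> < 1"
    "P = (\<Sum>k\<le>L. monom (F (int k)) k) - [:\<alpha> * \<gamma>:]"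
    "\<And>n. (\<Sum>k\<le>degree (P ^ n). \<bar>coeff (P ^ n) k\<bar>) \<le> C * (\<alpha> * (1 - \<gamma>)) ^ n"
proof -
  have F: "\<And>k. 0 \<le> F k"
    using assms(1) by (auto simp: is_prob_nonneg_def is_prob_def)
  obtain L C where C: "0 < C" and LC: "\<And>t. 1 - cos t \<le> C * sym_defect F L t"
    using aperiodic_sym_defect [OF assms] by blast
  define \<alpha> where "\<alpha> = (\<Sum>k\<le>L. F (int k))"
  define M where "M = (\<Sum>k\<le>L. F (int k) * (real k)\<^sup>2)"
  have M: "0 \<le> M"
    using F by (auto simp: M_def intro!: sum_nonneg)
  have "0 \<le> \<alpha>"
    using F by (auto simp: \<alpha>_def intro!: sum_nonneg)
  \<comment> \<open>At \<open>t = pi\<close> the left side of \<open>LC\<close> is 2, whereas a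
    truncation without mass has defect 0.\<close>
  moreover have "\<alpha> \<noteq> 0"
  proof
    assume "\<alpha> = 0"
    then have "F (int k) = 0" if "k \<le> L" for k
      using that F by (simp add: \<alpha>_def sum_nonneg_eq_0_iff)
    then have "sym_defect F L pi = 0"
      by (simp add: sym_defect_def)
    with LC [of pi] show False by simp
  qed
  ultimately have \<alpha>: "0 < \<alpha>" by simp
  \<comment> \<open>Chosen so that the loss \<open>2 * \<alpha> * \<gamma> * M * (1 - cos t)\<close>
    is at most half of the gain \<open>(1 - cos t) / C\<close>; \<open>M + 1\<close> avoids a
    division by zero, and \<open>1 / 2\<close> keeps \<open>\<gamma>\<close> below 1.\<close>
  define \<gamma> where "\<gamma> = min (1 / 2) (1 / (4 * C * \<alpha> * (M + 1)))"
  have \<gamma>: "0 < \<gamma>" "\<gamma> < 1"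
    using C \<alpha> M by (auto simp: \<gamma>_def)
  have \<gamma>M: "2 * \<alpha> * \<gamma> * M \<le> 1 / (2 * C)"
  proof -
    have "M + 1 > 0" using M by simp
    have "2 * \<alpha> * \<gamma> * M \<le> 2 * \<alpha> * (1 / (4 * C * \<alpha> * (M + 1))) * (M + 1)"
      using \<alpha> M C \<gamma> by (intro mult_mono) (auto simp: \<gamma>_def)
    also have "\<dots> = 1 / (2 * C)"
      using \<alpha> \<open>M + 1 > 0\<close> C by (simp add: divide_simps)
    finally show ?thesis .
  qed
  define r where "r = \<alpha> * (1 - \<gamma>)"
  have r: "0 < r"
    using \<alpha> \<gamma> by (simp add: r_def)
  define P where "P = (\<Sum>k\<le>L. monom (F (int k)) k) - [:\<alpha> * \<gamma>:]"
  define Q where "Q = map_poly complex_of_real P"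
  have "Q = (\<Sum>k\<le>L. monom (of_real (F (int k))) k) - [:of_real (\<alpha> * \<gamma>):]"
    by (rule poly_eqI)
      (simp add: Q_def P_def coeff_map_poly coeff_sum coeff_pCons of_real_sum if_distrib
        split: nat.split cong: if_cong)
  then have Q: "poly Q z = (\<Sum>k\<le>L. of_real (F (int k)) * z ^ k) - of_real (\<alpha> * \<gamma>)" for z
    by (simp add: poly_sum poly_monom)
  have Q_le: "(cmod (poly Q (cis t)))\<^sup>2 \<le> r\<^sup>2 - t\<^sup>2 / (16 * C)" if t: "\<bar>t\<bar> \<le> pi" for t
  proof -
    define f where "f = (\<Sum>k\<le>L. of_real (F (int k)) * cis t ^ k)"
    have Re_f: "Re f = (\<Sum>k\<le>L. F (int k) * cos (real k * t))"
      by (simp add: f_def Complex.DeMoivre Re_sum)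
    have "\<alpha> - Re f = (\<Sum>k\<le>L. F (int k) * (1 - cos (real k * t)))"
      by (simp add: Re_f \<alpha>_def right_diff_distrib sum_subtractf)
    also have "\<dots> \<le> (\<Sum>k\<le>L. F (int k) * ((real k)\<^sup>2 * (1 - cos t)))"
      using F by (intro sum_mono mult_left_mono one_minus_cos_mult_le) auto
    also have "\<dots> = M * (1 - cos t)"
      by (simp add: M_def sum_distrib_right mult.assoc)
    finally have "2 * \<alpha> * \<gamma> * (\<alpha> - Re f) \<le> 2 * \<alpha> * \<gamma> * (M * (1 - cos t))"
      using \<alpha> \<gamma> by (intro mult_left_mono) auto
    also have "\<dots> \<le> 1 / (2 * C) * (1 - cos t)"
      using mult_right_mono [OF \<gamma>M, of "1 - cos t"] by (simp add: mult_ac)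
    finally have 1: "2 * \<alpha> * \<gamma> * (\<alpha> - Re f) \<le> 1 / (2 * C) * (1 - cos t)" .
    have 2: "(1 - cos t) / C \<le> \<alpha>\<^sup>2 - (cmod f)\<^sup>2"
      using LC [of t] C by (simp add: sym_defect_eq f_def \<alpha>_def field_simps)
    \<comment> \<open>Expanding the square shows that the gap to \<open>r\<^sup>2\<close> is the
      defect of \<open>f\<close> minus a term linear in \<open>\<alpha> - Re f\<close>, which is
      itself of order \<open>1 - cos t\<close>.\<close>
    have "(cmod (f - of_real (\<alpha> * \<gamma>)))\<^sup>2 = (cmod f)\<^sup>2 - 2 * (\<alpha> * \<gamma>) * Re f + (\<alpha> * \<gamma>)\<^sup>2"
      unfolding cmod_power2 by (simp add: power2_eq_square algebra_simps)
    then have "r\<^sup>2 - (cmod (f - of_real (\<alpha> * \<gamma>)))\<^sup>2 = \<alpha>\<^sup>2 - (cmod f)\<^sup>2 - 2 * \<alpha> * \<gamma> * (\<alpha> - Re f)"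
      by (simp add: r_def power2_eq_square algebra_simps)
    also have "\<dots> \<ge> (1 - cos t) / C - 1 / (2 * C) * (1 - cos t)"
      using 1 2 by linarith
    moreover have "(1 - cos t) / C - 1 / (2 * C) * (1 - cos t) = (1 - cos t) / (2 * C)"
      using C by (simp add: field_simps)
    moreover have "(t\<^sup>2 / 8) / (2 * C) \<le> (1 - cos t) / (2 * C)"
      using C one_minus_cos_ge [OF t] by (intro divide_right_mono) auto
    ultimately show ?thesis
      by (simp add: Q f_def)
  qed
  \<comment> \<open>Division by \<open>r\<close> normalises the value at 1; then
    \<open>1 + u \<le> exp u\<close> turns the quadratic gap into Gaussian domination.\<close>
  define G where "G = smult (of_real (1 / r)) Q"
  have "\<exists>C'. \<forall>n. (\<Sum>k\<le>degree (G ^ n). cmod (coeff (G ^ n) k)) \<le> C'"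
  proof (rule power_coeffs_l1_bounded)
    show "poly G 1 = 1"
      using r \<alpha> \<gamma> by (simp add: G_def Q r_def \<alpha>_def algebra_simps flip: of_real_sum of_real_diff of_real_mult)
    show "0 < 1 / (16 * C * r\<^sup>2)"
      using C r by simp
    show "(cmod (poly G (cis t)))\<^sup>2 \<le> exp (- (1 / (16 * C * r\<^sup>2)) * t\<^sup>2)" if "\<bar>t\<bar> \<le> pi" for t
    proof -
      have "(cmod (poly G (cis t)))\<^sup>2 = (cmod (poly Q (cis t)))\<^sup>2 / r\<^sup>2"
        using r by (simp add: G_def norm_mult norm_divide power_divide)
      also have "\<dots> \<le> (r\<^sup>2 - t\<^sup>2 / (16 * C)) / r\<^sup>2"
        using Q_le [OF that] by (intro divide_right_mono) auto
      also have "\<dots> = 1 + - (1 / (16 * C * r\<^sup>2)) * t\<^sup>2"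
        using r C by (simp add: field_simps)
      also have "\<dots> \<le> exp (- (1 / (16 * C * r\<^sup>2)) * t\<^sup>2)"
        by (rule exp_ge_add_one_self)
      finally show ?thesis .
    qed
  qed
  then obtain C' where C': "\<And>n. (\<Sum>k\<le>degree (G ^ n). cmod (coeff (G ^ n) k)) \<le> C'"
    by blast
  have "(\<Sum>k\<le>degree (P ^ n). \<bar>coeff (P ^ n) k\<bar>) \<le> C' * r ^ n" for n
  proof -
    have Gn: "G ^ n = smult (of_real ((1 / r) ^ n)) (map_poly of_real (P ^ n))"
      by (simp add: G_def Q_def smult_power map_poly_of_real_power)
    have "degree (G ^ n) = degree (P ^ n)"
      using r by (simp add: Gn degree_map_poly)
    moreover have "cmod (coeff (G ^ n) k) = \<bar>coeff (P ^ n) k\<bar> / r ^ n" for k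
      using r by (simp add: Gn coeff_map_poly norm_mult norm_power norm_divide power_divide)
    ultimately have "(\<Sum>k\<le>degree (P ^ n). \<bar>coeff (P ^ n) k\<bar>) / r ^ n \<le> C'"
      using C' [of n] by (simp add: sum_divide_distrib)
    then show ?thesis
      using r by (simp add: pos_divide_le_eq)
  qed
  then show ?thesis
    using that [OF \<alpha>_def \<alpha> \<gamma> P_def] unfolding r_def by blast
qed

subsection \<open>Powers of and polynomials in bounded operators\<close>

lemma blinfun_compose_assoc: "(A o\<^sub>L B) o\<^sub>L C = A o\<^sub>L (B o\<^sub>L C)"
  by (rule blinfun_eqI) simp

lemma blinfun_compose_id [simp]: "A o\<^sub>L id_blinfun = A" "id_blinfun o\<^sub>L A = A"
  by (rule blinfun_eqI, simp)+

lemmas blinfun_compose_simps =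
  bounded_bilinear.add_left [OF bounded_bilinear_blinfun_compose]
  bounded_bilinear.add_right [OF bounded_bilinear_blinfun_compose]
  bounded_bilinear.diff_left [OF bounded_bilinear_blinfun_compose]
  bounded_bilinear.diff_right [OF bounded_bilinear_blinfun_compose]
  bounded_bilinear.scaleR_left [OF bounded_bilinear_blinfun_compose]
  bounded_bilinear.scaleR_right [OF bounded_bilinear_blinfun_compose]
  bounded_bilinear.sum_left [OF bounded_bilinear_blinfun_compose]
  bounded_bilinear.sum_right [OF bounded_bilinear_blinfun_compose]

lemma bounded_linear_blinfun_compose:
  "bounded_linear (\<lambda>X. A o\<^sub>L X)" "bounded_linear (\<lambda>X. X o\<^sub>L A)"
  by (rule bounded_bilinear.bounded_linear_right [OF bounded_bilinear_blinfun_compose]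
      bounded_bilinear.bounded_linear_left [OF bounded_bilinear_blinfun_compose])+

lemma blinfun_pow_commute:
  assumes "A o\<^sub>L B = B o\<^sub>L A"
  shows "A o\<^sub>L blinfun_pow B n = blinfun_pow B n o\<^sub>L A"
proof (induction n)
  case (Suc n)
  have "A o\<^sub>L (B o\<^sub>L blinfun_pow B n) = B o\<^sub>L (A o\<^sub>L blinfun_pow B n)"
    by (simp add: assms flip: blinfun_compose_assoc)
  with Suc show ?case
    by (simp add: blinfun_compose_assoc)
qed simp

lemma blinfun_pow_Suc_right: "blinfun_pow A (Suc n) = blinfun_pow A n o\<^sub>L A"
  using blinfun_pow_commute [of A A n] by simp

lemma blinfun_pow_add: "blinfun_pow A (m + n) = blinfun_pow A m o\<^sub>L blinfun_pow A n"
  by (induction m) (simp_all add: blinfun_compose_assoc)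

lemma blinfun_pow_scaleR: "blinfun_pow (c *\<^sub>R A) n = c ^ n *\<^sub>R blinfun_pow A n"
  by (induction n) (simp_all add: blinfun_compose_simps)

section \<open>The functional calculus for real polynomials\<close>

definition poly_op :: "real poly \<Rightarrow> ('a::real_normed_vector \<Rightarrow>\<^sub>L 'a) \<Rightarrow> ('a \<Rightarrow>\<^sub>L 'a)" where
  "poly_op p T = (\<Sum>k\<le>degree p. coeff p k *\<^sub>R blinfun_pow T k)"

lemma poly_op_0 [simp]: "poly_op 0 T = 0"
  by (simp add: poly_op_def)

lemma poly_op_pCons [simp]: "poly_op (pCons a p) T = a *\<^sub>R id_blinfun + (T o\<^sub>L poly_op p T)"
proof (cases "p = 0")
  case True
  then show ?thesis by (simp add: poly_op_def)
next
  case False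
  have "poly_op (pCons a p) T = (\<Sum>k\<le>Suc (degree p). coeff (pCons a p) k *\<^sub>R blinfun_pow T k)"
    using False by (simp add: poly_op_def degree_pCons_eq del: sum.atMost_Suc)
  also have "\<dots> = a *\<^sub>R id_blinfun + (T o\<^sub>L poly_op p T)"
    unfolding sum.atMost_Suc_shift by (simp add: poly_op_def blinfun_compose_simps)
  finally show ?thesis .
qed

lemma poly_op_1 [simp]: "poly_op 1 T = id_blinfun"
  by (simp add: one_pCons)

lemma poly_op_add: "poly_op (p + q) T = poly_op p T + poly_op q T"
  by (induction p q rule: poly_induct2) (simp_all add: blinfun_compose_simps scaleR_add_left)

lemma poly_op_smult: "poly_op (smult c p) T = c *\<^sub>R poly_op p T"
  by (induction p) (simp_all add: blinfun_compose_simps scaleR_add_right)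

lemma poly_op_diff: "poly_op (p - q) T = poly_op p T - poly_op q T"
  using poly_op_add [of "p - q" q T] by simp

lemma poly_op_sum: "poly_op (sum f I) T = (\<Sum>i\<in>I. poly_op (f i) T)"
  by (induction I rule: infinite_finite_induct) (simp_all add: poly_op_add)

lemma poly_op_monom: "poly_op (monom a k) T = a *\<^sub>R blinfun_pow T k"
  by (induction k) (simp_all add: monom_0 monom_Suc blinfun_compose_simps)

lemma poly_op_mult: "poly_op (p * q) T = poly_op p T o\<^sub>L poly_op q T"
  by (induction p) (simp_all add: poly_op_add poly_op_smult blinfun_compose_simps blinfun_compose_assoc)

lemma poly_op_power: "poly_op (p ^ n) T = blinfun_pow (poly_op p T) n"
  by (induction n) (simp_all add: poly_op_mult)

lemma poly_op_commute:
  assumes "A o\<^sub>L T = T o\<^sub>L A"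
  shows "A o\<^sub>L poly_op p T = poly_op p T o\<^sub>L A"
  by (simp add: poly_op_def blinfun_compose_simps blinfun_pow_commute [OF assms])

text \<open>Transfers l1 bounds on coefficients to operator norms. A bound \<open>N\<close> above
  the degree is allowed because cancellation may lower the degree of a difference.\<close>

lemma norm_poly_op_le:
  assumes "\<And>k. norm (blinfun_pow T k) \<le> C" and "degree p \<le> N"
  shows "norm (poly_op p T) \<le> C * (\<Sum>k\<le>N. \<bar>coeff p k\<bar>)"
proof -
  have "norm (poly_op p T) \<le> (\<Sum>k\<le>degree p. \<bar>coeff p k\<bar> * C)"
    unfolding poly_op_def using assms(1)
    by (intro sum_norm_le) (simp add: mult_left_mono)
  also have "\<dots> \<le> (\<Sum>k\<le>N. \<bar>coeff p k\<bar> * C)"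
    using assms(2) order.trans [OF norm_ge_zero assms(1)] by (intro sum_mono2) auto
  finally show ?thesis
    by (simp only: mult.commute [of C] sum_distrib_right)
qed

text \<open>
  Inserting powers of \<open>A\<close> and \<open>B\<close> on both sides of \<open>(A + B)\<^sup>n\<close> makes the bound inductive, without a
  binomial expansion.
\<close>

lemma blinfun_pow_add_le:
  fixes A B :: "'a::real_normed_vector \<Rightarrow>\<^sub>L 'a"
  assumes comm: "A o\<^sub>L B = B o\<^sub>L A"
    and A: "\<And>n. norm (blinfun_pow A n) \<le> C * a ^ n"
    and B: "\<And>n. norm (blinfun_pow B n) \<le> D * b ^ n"
  shows "norm (blinfun_pow (A + B) n) \<le> C * D * (a + b) ^ n"
proof -
  have "norm (blinfun_pow A i o\<^sub>L blinfun_pow (A + B) n o\<^sub>L blinfun_pow B j) \<le>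
      C * D * a ^ i * b ^ j * (a + b) ^ n" for i j
  proof (induction n arbitrary: i j)
    case 0
    have "norm (blinfun_pow A i o\<^sub>L blinfun_pow B j) \<le> norm (blinfun_pow A i) * norm (blinfun_pow B j)"
      by (rule norm_blinfun_compose)
    also have "\<dots> \<le> (C * a ^ i) * (D * b ^ j)"
      using A [of i] B [of j] by (intro mult_mono) (auto intro: order.trans [OF norm_ge_zero])
    finally show ?case by (simp add: mult_ac)
  next
    case (Suc n)
    let ?P = "blinfun_pow (A + B) n"
    have "B o\<^sub>L ?P = ?P o\<^sub>L B"
      using comm by (intro blinfun_pow_commute) (simp add: blinfun_compose_simps)
    then have "blinfun_pow A i o\<^sub>L blinfun_pow (A + B) (Suc n) o\<^sub>L blinfun_pow B j =
        (blinfun_pow A (Suc i) o\<^sub>L ?P o\<^sub>L blinfun_pow B j) +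
        (blinfun_pow A i o\<^sub>L ?P o\<^sub>L blinfun_pow B (Suc j))"
      unfolding blinfun_pow_Suc_right [of A]
      by (simp add: blinfun_compose_simps blinfun_compose_assoc)
    then have "norm (blinfun_pow A i o\<^sub>L blinfun_pow (A + B) (Suc n) o\<^sub>L blinfun_pow B j) \<le>
        C * D * a ^ Suc i * b ^ j * (a + b) ^ n + C * D * a ^ i * b ^ Suc j * (a + b) ^ n"
      using norm_triangle_mono [OF Suc.IH [of "Suc i" j] Suc.IH [of i "Suc j"]] by simp
    then show ?case
      by (simp add: algebra_simps)
  qed
  from this [of 0 0] show ?thesis by simp
qed

text \<open>Formally \<open>B\<^sup>n\<close> is a power series in \<open>T\<close> with nonnegative
  coefficients of total mass \<open>s ^ n\<close>. The induction carries an extra factor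
  \<open>blinfun_pow T j\<close>, which absorbs the powers of \<open>T\<close> from the series, so
  that \<open>C\<close> enters only once.\<close>

lemma blinfun_pow_nonneg_series_le:
  fixes T :: "'a::banach \<Rightarrow>\<^sub>L 'a" and b :: "nat \<Rightarrow> real"
  assumes T: "\<And>k. norm (blinfun_pow T k) \<le> C" and b: "\<And>k. 0 \<le> b k" "b sums s"
  defines "B \<equiv> (\<Sum>k. b k *\<^sub>R blinfun_pow T k)"
  shows "(\<lambda>k. b k *\<^sub>R blinfun_pow T k) sums B"
    and "norm (blinfun_pow B n) \<le> C * s ^ n"
proof -
  have C: "0 \<le> C"
    using T [of 0] norm_ge_zero order.trans by blast
  have "summable (\<lambda>k. b k *\<^sub>R blinfun_pow T k)"
  proof (rule summable_comparison_test')
    show "summable (\<lambda>k. b k * C)"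
      using b(2) by (intro summable_mult2) (simp add: sums_iff)
    show "norm (b k *\<^sub>R blinfun_pow T k) \<le> b k * C" if "0 \<le> k" for k
      using T b(1) by (simp add: mult_left_mono)
  qed
  then show sums: "(\<lambda>k. b k *\<^sub>R blinfun_pow T k) sums B"
    by (simp add: B_def summable_sums)
  have "norm (blinfun_pow B n o\<^sub>L blinfun_pow T j) \<le> C * s ^ n" for j
  proof (induction n arbitrary: j)
    case (Suc n)
    have 1: "(\<lambda>k. b k *\<^sub>R (blinfun_pow B n o\<^sub>L blinfun_pow T (k + j))) sums
        (blinfun_pow B n o\<^sub>L (B o\<^sub>L blinfun_pow T j))"
      using bounded_linear.sums [OF bounded_linear_blinfun_compose(1) [of "blinfun_pow B n"]
          bounded_linear.sums [OF bounded_linear_blinfun_compose(2) [of "blinfun_pow T j"] sums]]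
      by (simp add: blinfun_compose_simps blinfun_pow_add)
    have 2: "(\<lambda>k. b k * (C * s ^ n)) sums (s * (C * s ^ n))"
      using b(2) by (rule sums_mult2)
    have "norm (blinfun_pow B n o\<^sub>L (B o\<^sub>L blinfun_pow T j)) \<le> s * (C * s ^ n)"
      using Suc.IH b(1) by (intro norm_sums_le [OF 1 2]) (simp add: mult_left_mono)
    moreover have "blinfun_pow B (Suc n) o\<^sub>L blinfun_pow T j = blinfun_pow B n o\<^sub>L (B o\<^sub>L blinfun_pow T j)"
      by (simp only: blinfun_pow_Suc_right blinfun_compose_assoc)
    ultimately show ?case by (simp add: mult_ac)
  qed (use T in simp)
  from this [of 0] show "norm (blinfun_pow B n) \<le> C * s ^ n" by simp
qed

subsection \<open>Differences of binomial probabilities\<close>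

text \<open>The variance of the binomial distribution, obtained from its total mass, its mean and
  its second factorial moment.\<close>

lemma sum_Bernstein_variance:
  "(\<Sum>k\<le>n. (real n * x - real k)\<^sup>2 * Bernstein n k x) = real n * x * (1 - x)"
proof -
  have "(real n * x - real k)\<^sup>2 * Bernstein n k x = real k * (real k - 1) * Bernstein n k x +
      (1 - 2 * (real n * x)) * (real k * Bernstein n k x) + (real n * x)\<^sup>2 * Bernstein n k x" for k
    by (simp add: algebra_simps power2_eq_square)
  then have "(\<Sum>k\<le>n. (real n * x - real k)\<^sup>2 * Bernstein n k x) =
      real n * (real n - 1) * x\<^sup>2 + (1 - 2 * (real n * x)) * (real n * x) + (real n * x)\<^sup>2"
    by (simp add: sum.distrib flip: sum_distrib_left)
  then show ?thesis
    by (simp add: algebra_simps power2_eq_square)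
qed

lemma coeff_bernoulli_power: "coeff ([:1 - x, x:] ^ n) k = Bernstein n k x"
proof (cases "k \<le> n")
  case True
  then show ?thesis by (simp add: coeff_linear_poly_power Bernstein_def)
next
  case False
  have "degree ([:1 - x, x:] ^ n) \<le> degree [:1 - x, x:] * n"
    by (rule degree_power_le)
  also have "\<dots> \<le> n"
    by simp
  finally show ?thesis
    using False by (simp add: coeff_eq_0 Bernstein_def)
qed

text \<open>The difference is \<open>x\<close> times \<open>(1 - X) * p ^ n\<close> with
  \<open>p = [:1 - x, x:]\<close>, so its coefficients are differences of neighbouring binomial
  probabilities. Two absorption identities express both neighbours through
  \<open>Bernstein (Suc n) k x\<close>, leaving the deviation of \<open>k\<close> from the
  mean.\<close>

lemma coeff_bernoulli_power_diff:
  assumes x: "0 < x" "x < 1" and "k \<le> Suc n"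
  shows "coeff ([:1 - x, x:] ^ n - [:1 - x, x:] ^ Suc n) k =
    Bernstein (Suc n) k x * (real (Suc n) * x - real k) / (real (Suc n) * (1 - x))"
proof -
  let ?p = "[:1 - x, x:]"
  have "?p ^ n - ?p ^ Suc n = smult x (?p ^ n - pCons 0 (?p ^ n))"
    by (simp add: smult_diff_left smult_diff_right)
  then have *: "coeff (?p ^ n - ?p ^ Suc n) k = x * (Bernstein n k x - (case k of 0 \<Rightarrow> 0 | Suc j \<Rightarrow> Bernstein n j x))"
    by (simp add: coeff_bernoulli_power coeff_pCons split: nat.split)
  have 1: "real (Suc n) * (1 - x) * Bernstein n k x = (real (Suc n) - real k) * Bernstein (Suc n) k x"
  proof (cases "k = Suc n")
    case False
    then have k: "k \<le> n" using assms by simp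
    have "real ((Suc n - k) * (Suc n choose k)) = real (Suc n * (n choose k))"
      using binomial_absorb_comp [of "Suc n" k] by simp
    then have "real (Suc n) * real (n choose k) = (real (Suc n) - real k) * real (Suc n choose k)"
      using k by (simp only: of_nat_mult of_nat_diff le_SucI)
    then have "real (Suc n) * real (n choose k) * (x ^ k * ((1 - x) * (1 - x) ^ (n - k))) =
        (real (Suc n) - real k) * real (Suc n choose k) * (x ^ k * ((1 - x) * (1 - x) ^ (n - k)))"
      by (simp only:)
    then show ?thesis
      using k by (simp only: Bernstein_def Suc_diff_le power_Suc mult_ac)
  qed (simp add: Bernstein_def)
  have 2: "real (Suc n) * x * (case k of 0 \<Rightarrow> 0 | Suc j \<Rightarrow> Bernstein n j x) = real k * Bernstein (Suc n) k x"
  proof (cases k)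
    case (Suc j)
    have "real (Suc j * (Suc n choose Suc j)) = real (Suc n * (n choose j))"
      by (simp only: Suc_times_binomial)
    then have "real (Suc n) * real (n choose j) * (x * x ^ j * (1 - x) ^ (n - j)) =
        real (Suc j) * real (Suc n choose Suc j) * (x * x ^ j * (1 - x) ^ (n - j))"
      by (simp only: of_nat_mult)
    then show ?thesis
      by (simp only: Suc Bernstein_def nat.case power_Suc diff_Suc_Suc mult_ac)
  qed simp
  have "coeff (?p ^ n - ?p ^ Suc n) k * (real (Suc n) * (1 - x)) =
      x * (real (Suc n) * (1 - x) * Bernstein n k x) -
      (1 - x) * (real (Suc n) * x * (case k of 0 \<Rightarrow> 0 | Suc j \<Rightarrow> Bernstein n j x))"
    unfolding * by (simp add: algebra_simps)
  also have "\<dots> = Bernstein (Suc n) k x * (real (Suc n) * x - real k)"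
    unfolding 1 2 by (simp add: algebra_simps)
  finally show ?thesis
    using x by (subst nonzero_eq_divide_eq) auto
qed

text \<open>The sum is a mean absolute deviation divided by \<open>m * (1 - x)\<close>; by
  Cauchy-Schwarz it is at most the standard deviation \<open>sqrt (m * x * (1 - x))\<close> over the
  same factor.\<close>

lemma sum_abs_bernoulli_power_diff_le:
  assumes x: "0 < x" "x < 1"
  shows "(\<Sum>k\<le>Suc n. \<bar>coeff ([:1 - x, x:] ^ n - [:1 - x, x:] ^ Suc n) k\<bar>) \<le>
    sqrt (x / (1 - x)) / sqrt (real (Suc n))"
proof -
  define m where "m = real (Suc n)"
  have m: "m > 0" by (simp add: m_def)
  let ?B = "\<lambda>k. Bernstein (Suc n) k x"
  have B: "0 \<le> ?B k" for k
    using x by (simp add: Bernstein_nonneg)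
  have "(\<Sum>k\<le>Suc n. sqrt (?B k) * (sqrt (?B k) * \<bar>m * x - real k\<bar>))\<^sup>2 \<le>
      (\<Sum>k\<le>Suc n. (sqrt (?B k))\<^sup>2) * (\<Sum>k\<le>Suc n. (sqrt (?B k) * \<bar>m * x - real k\<bar>)\<^sup>2)"
    by (rule Cauchy_Schwarz_ineq_sum)
  also have "\<dots> = (\<Sum>k\<le>Suc n. ?B k) * (\<Sum>k\<le>Suc n. (m * x - real k)\<^sup>2 * ?B k)"
    using B by (simp add: power_mult_distrib mult.commute del: sum.atMost_Suc)
  also have "\<dots> = m * x * (1 - x)"
    unfolding m_def by (simp only: sum_Bernstein_variance sum_Bernstein mult_1)
  finally have le: "(\<Sum>k\<le>Suc n. ?B k * \<bar>m * x - real k\<bar>) \<le> sqrt (m * x * (1 - x))"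
    using B by (intro real_le_rsqrt) (simp add: mult.assoc [symmetric] del: sum.atMost_Suc)
  have "(\<Sum>k\<le>Suc n. \<bar>coeff ([:1 - x, x:] ^ n - [:1 - x, x:] ^ Suc n) k\<bar>) =
      (\<Sum>k\<le>Suc n. ?B k * \<bar>m * x - real k\<bar> / (m * (1 - x)))"
    using x B m unfolding m_def
    by (intro sum.cong refl) (simp only: coeff_bernoulli_power_diff atMost_iff abs_mult abs_divide, simp)
  also have "\<dots> \<le> sqrt (m * x * (1 - x)) / (m * (1 - x))"
    using le m x by (simp add: divide_right_mono del: sum.atMost_Suc flip: sum_divide_distrib)
  also have "\<dots> = sqrt (x / (1 - x)) / sqrt m"
  proof -
    have "sqrt (m * x * (1 - x)) / (m * (1 - x)) =
        (sqrt m * sqrt x * sqrt (1 - x)) / ((sqrt m * sqrt m) * (sqrt (1 - x) * sqrt (1 - x)))"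
      using m x by (simp add: real_sqrt_mult)
    also have "\<dots> = sqrt x / sqrt (1 - x) / sqrt m"
      using m x by (simp add: divide_simps del: real_sqrt_mult_self)
    finally show ?thesis by (simp add: real_sqrt_divide)
  qed
  finally show ?thesis by (simp add: m_def)
qed

subsection \<open>Neumann series and the spectrum\<close>

text \<open>Multiplication by a complex scalar as a real-linear operator. Complex linearity thereby
  becomes a commutation relation, which passes to compositions, series and inverses.\<close>

lift_definition scaleC_op :: "complex \<Rightarrow> ('a::complex_normed_vector \<Rightarrow>\<^sub>L 'a)" is "\<lambda>c x. c *\<^sub>C x"
proof -
  fix c :: complex
  show "bounded_linear (\<lambda>x::'a. c *\<^sub>C x)"
    by (rule bounded_linear_intro [where K = "cmod c"])
      (simp_all add: scaleC_add_right scaleR_scaleC scaleC_scaleC norm_scaleC mult.commute)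
qed

lemma scaleC_op_apply [simp]: "blinfun_apply (scaleC_op c) x = c *\<^sub>C x"
  by (simp add: scaleC_op.rep_eq)

lemma clinear_op_iff: "clinear_op A \<longleftrightarrow> (\<forall>c. scaleC_op c o\<^sub>L A = A o\<^sub>L scaleC_op c)"
proof
  assume "clinear_op A"
  then show "\<forall>c. scaleC_op c o\<^sub>L A = A o\<^sub>L scaleC_op c"
    by (auto simp: clinear_op_def intro!: blinfun_eqI)
next
  assume "\<forall>c. scaleC_op c o\<^sub>L A = A o\<^sub>L scaleC_op c"
  then show "clinear_op A"
    unfolding clinear_op_def by (metis blinfun_apply_blinfun_compose scaleC_op_apply)
qed

lemma norm_scaleC_op_le: "norm (scaleC_op c) \<le> cmod c"
  by (rule norm_blinfun_bound) (simp_all add: norm_scaleC)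

lemma suminf_commute:
  fixes f :: "nat \<Rightarrow> ('a::banach \<Rightarrow>\<^sub>L 'a)"
  assumes "f sums S" and "\<And>k. A o\<^sub>L f k = f k o\<^sub>L A"
  shows "A o\<^sub>L S = S o\<^sub>L A"
  using bounded_linear.sums [OF bounded_linear_blinfun_compose(1) [of A] assms(1)]
    bounded_linear.sums [OF bounded_linear_blinfun_compose(2) [of A] assms(1)]
  by (simp add: assms(2) sums_unique2)

text \<open>\<open>N\<close> is the sum of the powers of \<open>V\<close>, the inverse of
  \<open>I - V\<close>. Geometric decay of the powers suffices, even if
  \<open>norm V \<ge> 1\<close>. The third property is what later yields complex linearity of the
  resolvent.\<close>

lemma neumann_series:
  fixes V :: "'a::banach \<Rightarrow>\<^sub>L 'a"
  assumes V: "\<And>n. norm (blinfun_pow V n) \<le> C * q ^ n" and q: "0 \<le> q" "q < 1"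
  obtains N where "N o\<^sub>L V = N - id_blinfun" "V o\<^sub>L N = N - id_blinfun"
    "\<And>A. A o\<^sub>L V = V o\<^sub>L A \<Longrightarrow> A o\<^sub>L N = N o\<^sub>L A"
proof -
  have "summable (blinfun_pow V)"
    by (rule summable_comparison_test' [of "\<lambda>n. C * q ^ n" 0])
      (use V q in \<open>auto intro!: summable_mult summable_geometric\<close>)
  then obtain N where N: "blinfun_pow V sums N"
    by (auto simp: summable_def)
  have comm: "A o\<^sub>L N = N o\<^sub>L A" if "A o\<^sub>L V = V o\<^sub>L A" for A
    by (rule suminf_commute [OF N blinfun_pow_commute [OF that]])
  have "(\<lambda>n. blinfun_pow V (Suc n)) sums (V o\<^sub>L N)"
    using bounded_linear.sums [OF bounded_linear_blinfun_compose(1) [of V] N] by simp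
  moreover have "(\<lambda>n. blinfun_pow V (Suc n)) sums (N - id_blinfun)"
    using sums_Suc_iff [of "blinfun_pow V" "N - id_blinfun"] N by simp
  ultimately have "V o\<^sub>L N = N - id_blinfun"
    by (rule sums_unique2)
  with comm [of V] comm show ?thesis
    by (intro that [of N]) auto
qed

text \<open>For \<open>z\<close> outside the disc and \<open>w = z - a\<close>, one has
  \<open>z - Q = w (I - V)\<close> with \<open>V = (Q - a) / w\<close>. The powers of
  \<open>V\<close> decay like \<open>(b / cmod w) ^ n\<close>, so the Neumann series provides the
  resolvent.\<close>

lemma op_spectrum_subset_cball:
  fixes Q :: "'a::complex_banach \<Rightarrow>\<^sub>L 'a"
  assumes Q: "clinear_op Q" and b: "0 < b"
    and W: "\<And>n. norm (blinfun_pow (Q - a *\<^sub>R id_blinfun) n) \<le> C * b ^ n"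
  shows "op_spectrum Q \<subseteq> {z. cmod (z - complex_of_real a) \<le> b}"
proof (rule ccontr)
  assume "\<not> ?thesis"
  then obtain z where z: "z \<in> op_spectrum Q" "b < cmod (z - of_real a)"
    by force
  define w where "w = z - of_real a"
  have w: "b < cmod w" "w \<noteq> 0"
    using z(2) b by (auto simp: w_def)
  define W where "W = Q - a *\<^sub>R id_blinfun"
  define V where "V = scaleC_op (1 / w) o\<^sub>L W"
  have W_comm: "scaleC_op c o\<^sub>L W = W o\<^sub>L scaleC_op c" for c
    using Q by (simp add: clinear_op_iff W_def blinfun_compose_simps)
  have V_comm: "scaleC_op c o\<^sub>L V = V o\<^sub>L scaleC_op c" for c
  proof -
    have "(scaleC_op c :: 'a \<Rightarrow>\<^sub>L 'a) o\<^sub>L scaleC_op (1 / w) = scaleC_op (1 / w) o\<^sub>L scaleC_op c"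
      by (rule blinfun_eqI) (simp add: scaleC_scaleC mult.commute)
    then have "scaleC_op c o\<^sub>L V = scaleC_op (1 / w) o\<^sub>L (scaleC_op c o\<^sub>L W)"
      by (simp only: V_def flip: blinfun_compose_assoc)
    also have "\<dots> = V o\<^sub>L scaleC_op c"
      by (simp only: V_def W_comm [of c] blinfun_compose_assoc)
    finally show ?thesis .
  qed
  have pow_V: "blinfun_pow V n = scaleC_op ((1 / w) ^ n) o\<^sub>L blinfun_pow W n" for n
  proof (induction n)
    case 0
    then show ?case by (auto intro!: blinfun_eqI simp: scaleC_one)
  next
    case (Suc n)
    have "blinfun_pow V (Suc n) = scaleC_op (1 / w) o\<^sub>L (W o\<^sub>L scaleC_op ((1 / w) ^ n)) o\<^sub>L blinfun_pow W n"
      unfolding blinfun_pow.simps Suc by (simp only: V_def blinfun_compose_assoc)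
    also have "\<dots> = scaleC_op ((1 / w) ^ Suc n) o\<^sub>L blinfun_pow W (Suc n)"
      unfolding W_comm [symmetric] by (rule blinfun_eqI) (simp add: scaleC_scaleC)
    finally show ?case .
  qed
  have V_le: "norm (blinfun_pow V n) \<le> C * (b / cmod w) ^ n" for n
  proof -
    have "norm (blinfun_pow V n) \<le> norm (scaleC_op ((1 / w) ^ n) :: 'a \<Rightarrow>\<^sub>L 'a) * norm (blinfun_pow W n)"
      unfolding pow_V by (rule norm_blinfun_compose)
    also have "\<dots> \<le> cmod ((1 / w) ^ n) * (C * b ^ n)"
      using W by (intro mult_mono norm_scaleC_op_le) (auto simp: W_def)
    finally show ?thesis
      by (simp add: norm_power norm_divide power_divide)
  qed
  obtain N where N: "N o\<^sub>L V = N - id_blinfun" "V o\<^sub>L N = N - id_blinfun"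
    "\<And>A. A o\<^sub>L V = V o\<^sub>L A \<Longrightarrow> A o\<^sub>L N = N o\<^sub>L A"
    using neumann_series [OF V_le] w b by auto
  have N_comm: "blinfun_apply N (c *\<^sub>C x) = c *\<^sub>C blinfun_apply N x" for c x
    using N(3) [OF V_comm] by (metis blinfun_apply_blinfun_compose scaleC_op_apply)
  have NV: "N (V x) = N x - x" "V (N x) = N x - x" for x
    using N(1,2) by (metis blinfun_apply_blinfun_compose blinfun_apply_id_blinfun blinfun.diff_left)+
  have diff: "c *\<^sub>C (x - y) = c *\<^sub>C x - c *\<^sub>C y" for c and x y :: 'a
    using blinfun.diff_right [of "scaleC_op c" x y] by simp
  have zQ: "z *\<^sub>C x - Q x = w *\<^sub>C (x - V x)" for x
  proof -
    have "w *\<^sub>C V x = Q x - complex_of_real a *\<^sub>C x"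
      using w by (simp add: V_def W_def scaleC_scaleC scaleC_one diff blinfun.bilinear_simps scaleR_scaleC)
    moreover have "z *\<^sub>C x = w *\<^sub>C x + complex_of_real a *\<^sub>C x"
      by (simp add: w_def flip: scaleC_add_left)
    ultimately show ?thesis
      by (simp add: diff)
  qed
  \<comment> \<open>The resolvent: \<open>N\<close> inverts \<open>I - V\<close>, and
    \<open>1 / w\<close> undoes the scalar factor in \<open>zQ\<close>.\<close>
  define R where "R = N o\<^sub>L scaleC_op (1 / w)"
  have "clinear_op R"
    by (simp add: clinear_op_def R_def N_comm scaleC_scaleC mult.commute)
  moreover have "R (z *\<^sub>C x - Q x) = x" for x
    using w by (simp add: zQ R_def scaleC_scaleC scaleC_one blinfun.diff_right NV)
  moreover have "z *\<^sub>C R x - Q (R x) = x" for x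
    unfolding zQ using w by (simp add: R_def NV scaleC_scaleC scaleC_one)
  ultimately show False
    using z(1) unfolding op_spectrum_def by blast
qed

text \<open>If also \<open>1 \<le> cmod z\<close>, the squared inequalities share their quadratic
  terms, and combining them leaves \<open>1 - b \<le> (1 - b) * Re z\<close>. Hence
  \<open>Re z = 1\<close>, the rightmost abscissa of the disc, and \<open>Im z = 0\<close>.\<close>

lemma disc_tangent_at_1_subset:
  fixes b :: real
  assumes "0 < b" "b < 1"
  shows "{z. cmod (z - complex_of_real (1 - b)) \<le> b} \<subseteq> ball 0 1 \<union> {1}"
proof clarify
  fix z assume z: "cmod (z - complex_of_real (1 - b)) \<le> b" and "z \<notin> ball 0 1"
  then have "1 \<le> cmod z" by simp
  then have 1: "1 \<le> (Re z)\<^sup>2 + (Im z)\<^sup>2"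
    by (metis cmod_power2 one_le_power)
  have "(cmod (z - complex_of_real (1 - b)))\<^sup>2 \<le> b\<^sup>2"
    using z by (intro power_mono) auto
  then have 2: "(Re z - (1 - b))\<^sup>2 + (Im z)\<^sup>2 \<le> b\<^sup>2"
    by (simp add: cmod_power2)
  have "(1 - b) * 1 \<le> (1 - b) * Re z"
    using 1 2 by (simp add: power2_eq_square algebra_simps)
  then have "1 \<le> Re z"
    using assms by (simp only: mult_le_cancel_left_pos diff_gt_0_iff_gt)
  moreover have "Re z \<le> 1"
    using abs_Re_le_cmod [of "z - complex_of_real (1 - b)"] z by simp
  ultimately have "Re z = 1" by simp
  with 2 have "Im z = 0" by simp
  with \<open>Re z = 1\<close> show "z = 1"
    by (simp add: complex_eq_iff)
qed

subsection \<open>The operator \<open>\<Psi>(F;T)\<close>\<close>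

lemma blinfun_pow_diff_bounded:
  fixes Q :: "'a::real_normed_vector \<Rightarrow>\<^sub>L 'a"
  assumes b: "0 < b" "b < 1"
    and W: "\<And>n. norm (blinfun_pow (Q - (1 - b) *\<^sub>R id_blinfun) n) \<le> C * b ^ n"
  shows "sqrt (real n) * norm (blinfun_pow Q n - blinfun_pow Q (n + 1)) \<le> C * sqrt (b / (1 - b))"
proof -
  \<comment> \<open>\<open>Q = (1 - b) I + b S\<close> is the Bernoulli polynomial evaluated at
    \<open>S\<close>, and the hypothesis \<open>W\<close> says that \<open>S\<close> is
    power-bounded by \<open>C\<close>.\<close>
  define S where "S = (1 / b) *\<^sub>R (Q - (1 - b) *\<^sub>R id_blinfun)"
  have S: "norm (blinfun_pow S k) \<le> C" for k
    using W [of k] b by (simp add: S_def blinfun_pow_scaleR power_divide divide_simps)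
  have C: "0 \<le> C"
    using S [of 0] norm_ge_zero order.trans by blast
  let ?p = "[:1 - b, b:]"
  have "poly_op ?p S = Q"
    using b by (simp add: S_def blinfun_compose_simps)
  then have eq: "blinfun_pow Q n - blinfun_pow Q (n + 1) = poly_op (?p ^ n - ?p ^ Suc n) S"
    by (simp only: poly_op_diff poly_op_power Suc_eq_plus1)
  have deg: "degree (?p ^ m) \<le> m" for m
    using degree_power_le [of ?p m] b by simp
  have "norm (blinfun_pow Q n - blinfun_pow Q (n + 1)) \<le>
      C * (\<Sum>k\<le>Suc n. \<bar>coeff (?p ^ n - ?p ^ Suc n) k\<bar>)"
    unfolding eq by (intro norm_poly_op_le S degree_diff_le deg order.trans [OF deg]) simp
  also have "\<dots> \<le> C * (sqrt (b / (1 - b)) / sqrt (real (Suc n)))"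
    using C b by (intro mult_left_mono sum_abs_bernoulli_power_diff_le)
  finally have "sqrt (real n) * norm (blinfun_pow Q n - blinfun_pow Q (n + 1)) \<le>
      sqrt (real (Suc n)) * (C * (sqrt (b / (1 - b)) / sqrt (real (Suc n))))"
    by (intro mult_mono) auto
  then show ?thesis by simp
qed

lemma is_prob_nonneg_sums:
  assumes "is_prob_nonneg F"
  shows "(\<lambda>k. F (int k)) sums 1"
proof -
  have "(F has_sum 1) UNIV" and neg: "\<And>k. k < 0 \<Longrightarrow> F k = 0"
    using assms by (auto simp: is_prob_nonneg_def is_prob_def)
  then have "(F has_sum 1) (range int)"
    by (subst has_sum_cong_neutral [where T = UNIV and g = F])
      (auto simp: image_iff, metis neg nonneg_int_cases not_le)
  then have "((\<lambda>k. F (int k)) has_sum 1) UNIV"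
    by (simp add: has_sum_reindex o_def)
  then show ?thesis
    by (rule has_sum_imp_sums)
qed

lemma Psi_decomposition:
  fixes T :: "'a::banach \<Rightarrow>\<^sub>L 'a"
  assumes "power_bounded T" and F: "is_prob_nonneg F" "aperiodic F"
  obtains b C where "0 < b" "b < 1"
    "\<And>n. norm (blinfun_pow (Psi F T - (1 - b) *\<^sub>R id_blinfun) n) \<le> C * b ^ n"
proof -
  obtain M where M: "\<And>k. norm (blinfun_pow T k) \<le> M"
    using assms(1) by (auto simp: power_bounded_def)
  have M0: "0 \<le> M"
    using M [of 0] norm_ge_zero order.trans by blast
  have F0: "0 \<le> F k" for k
    using F(1) by (auto simp: is_prob_nonneg_def is_prob_def)
  obtain L \<alpha> \<gamma> P C where \<alpha>: "\<alpha> = (\<Sum>k\<le>L. F (int k))" "0 < \<alpha>" and \<gamma>: "0 < \<gamma>" "\<gamma> < 1"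
    and P: "P = (\<Sum>k\<le>L. monom (F (int k)) k) - [:\<alpha> * \<gamma>:]"
    and C: "\<And>n. (\<Sum>k\<le>degree (P ^ n). \<bar>coeff (P ^ n) k\<bar>) \<le> C * (\<alpha> * (1 - \<gamma>)) ^ n"
    by (rule truncation_power_coeffs_bounded [OF F]) blast
  note sums_F = is_prob_nonneg_sums [OF F(1)]
  define A where "A = poly_op P T"
  have A_le: "norm (blinfun_pow A n) \<le> M * C * (\<alpha> * (1 - \<gamma>)) ^ n" for n
  proof -
    have "norm (blinfun_pow A n) \<le> M * (\<Sum>k\<le>degree (P ^ n). \<bar>coeff (P ^ n) k\<bar>)"
      unfolding A_def poly_op_power [symmetric] by (rule norm_poly_op_le [OF M order.refl])
    also have "\<dots> \<le> M * (C * (\<alpha> * (1 - \<gamma>)) ^ n)"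
      by (intro mult_left_mono C M0)
    finally show ?thesis by (simp add: mult.assoc)
  qed
  \<comment> \<open>The tail of \<open>F\<close> beyond \<open>L\<close>, of mass
    \<open>1 - \<alpha>\<close>; it stays nonnegative, so the series bound applies to it.\<close>
  define f where "f k = (if k \<le> L then 0 else F (int k))" for k :: nat
  have "(\<lambda>k. if k \<in> {..L} then F (int k) else 0) sums \<alpha>"
    unfolding \<alpha>(1) by (rule sums_If_finite_set) simp
  from sums_diff [OF sums_F this] have sums_f: "f sums (1 - \<alpha>)"
    by (rule sums_cong [THEN iffD1, rotated]) (simp add: f_def)
  have f0: "0 \<le> f k" for k
    by (simp add: f_def F0)
  define B where "B = (\<Sum>k. f k *\<^sub>R blinfun_pow T k)"
  have sums_B: "(\<lambda>k. f k *\<^sub>R blinfun_pow T k) sums B"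
    and B_le: "norm (blinfun_pow B n) \<le> M * (1 - \<alpha>) ^ n" for n
    using blinfun_pow_nonneg_series_le [OF M f0 sums_f] by (simp_all add: B_def)
  have "T o\<^sub>L B = B o\<^sub>L T"
    by (rule suminf_commute [OF sums_B])
      (simp add: blinfun_compose_simps blinfun_pow_commute)
  then have comm: "A o\<^sub>L B = B o\<^sub>L A"
    unfolding A_def by (intro poly_op_commute [symmetric]) simp
  have "(\<lambda>k. (if k \<in> {..L} then F (int k) *\<^sub>R blinfun_pow T k else 0) + f k *\<^sub>R blinfun_pow T k)
      sums ((\<Sum>k\<le>L. F (int k) *\<^sub>R blinfun_pow T k) + B)"
    by (intro sums_add sums_If_finite_set sums_B) simp
  moreover have "(\<lambda>k. (if k \<in> {..L} then F (int k) *\<^sub>R blinfun_pow T k else 0) + f k *\<^sub>R blinfun_pow T k)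
      = (\<lambda>k. F (int k) *\<^sub>R blinfun_pow T k)"
    by (auto simp: f_def)
  ultimately have "Psi F T = (\<Sum>k\<le>L. F (int k) *\<^sub>R blinfun_pow T k) + B"
    by (simp add: Psi_def sums_iff)
  moreover have "A = (\<Sum>k\<le>L. F (int k) *\<^sub>R blinfun_pow T k) - (\<alpha> * \<gamma>) *\<^sub>R id_blinfun"
    by (simp add: A_def P poly_op_diff poly_op_sum poly_op_monom)
  ultimately have Psi: "Psi F T - (1 - (1 - \<alpha> * \<gamma>)) *\<^sub>R id_blinfun = A + B"
    by simp
  \<comment> \<open>Needed for the radius \<open>1 - \<alpha> * \<gamma>\<close> to be
    positive.\<close>
  have "\<alpha> \<le> 1"
    using sum_le_suminf [of "\<lambda>k. F (int k)" "{..L}"] sums_F F0 by (simp add: \<alpha>(1) sums_iff)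
  then have "\<alpha> * \<gamma> < 1"
    using \<gamma> mult_right_mono [of \<alpha> 1 \<gamma>] by linarith
  \<comment> \<open>The growth rates of \<open>A\<close> and \<open>B\<close> add up exactly to the
    mass left after removing \<open>\<alpha> * \<gamma>\<close>; any excess would destroy the
    power-boundedness of the rescaled operator.\<close>
  have "\<alpha> * (1 - \<gamma>) + (1 - \<alpha>) = 1 - \<alpha> * \<gamma>"
    by (simp add: algebra_simps)
  with blinfun_pow_add_le [OF comm A_le B_le]
  have "norm (blinfun_pow (Psi F T - (1 - (1 - \<alpha> * \<gamma>)) *\<^sub>R id_blinfun) n) \<le> M * C * M * (1 - \<alpha> * \<gamma>) ^ n" for n
    unfolding Psi by metis
  then show ?thesis
    using \<alpha>(2) \<gamma> \<open>\<alpha> * \<gamma> < 1\<close> by (intro that [of "1 - \<alpha> * \<gamma>" "M * C * M"]) auto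
qed

lemma clinear_op_Psi:
  fixes T :: "'a::complex_banach \<Rightarrow>\<^sub>L 'a"
  assumes "clinear_op T" "power_bounded T" "is_prob_nonneg F"
  shows "clinear_op (Psi F T)"
  unfolding clinear_op_iff
proof
  fix c
  obtain M where M: "\<And>k. norm (blinfun_pow T k) \<le> M"
    using assms(2) by (auto simp: power_bounded_def)
  have F0: "0 \<le> F k" for k
    using assms(3) by (auto simp: is_prob_nonneg_def is_prob_def)
  have "(\<lambda>k. F (int k) *\<^sub>R blinfun_pow T k) sums Psi F T"
    unfolding Psi_def by (rule blinfun_pow_nonneg_series_le(1) [OF M F0 is_prob_nonneg_sums [OF assms(3)]])
  moreover have "scaleC_op c o\<^sub>L (F (int k) *\<^sub>R blinfun_pow T k) = (F (int k) *\<^sub>R blinfun_pow T k) o\<^sub>L scaleC_op c" for k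
    using blinfun_pow_commute [of "scaleC_op c" T k] assms(1)
    by (simp add: blinfun_compose_simps clinear_op_iff)
  ultimately show "scaleC_op c o\<^sub>L Psi F T = Psi F T o\<^sub>L scaleC_op c"
    by (rule suminf_commute)
qed

theorem theorem3p2:
  fixes T :: "'a::complex_banach \<Rightarrow>\<^sub>L 'a" and F :: "int \<Rightarrow> real"
  assumes "clinear_op T" and "power_bounded T"
    and "is_prob_nonneg F" and "aperiodic F"
  shows "(\<exists>C. \<forall>n::nat. sqrt (real n) *
            norm (blinfun_pow (Psi F T) n - blinfun_pow (Psi F T) (n + 1)) \<le> C)
    \<and> (\<exists>\<beta>::real. 0 < \<beta> \<and> \<beta> < 1 \<and>
         op_spectrum (Psi F T) \<subseteq> {z. cmod (z - complex_of_real (1 - \<beta>)) \<le> \<beta>} \<and>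
         {z. cmod (z - complex_of_real (1 - \<beta>)) \<le> \<beta>} \<subseteq> ball 0 1 \<union> {1})"
proof -
  obtain b C where b: "0 < b" "b < 1"
    and W: "\<And>n. norm (blinfun_pow (Psi F T - (1 - b) *\<^sub>R id_blinfun) n) \<le> C * b ^ n"
    using Psi_decomposition [OF assms(2-4)] by blast
  show ?thesis
    using blinfun_pow_diff_bounded [OF b W] disc_tangent_at_1_subset [OF b] b
      op_spectrum_subset_cball [OF clinear_op_Psi [OF assms(1-3)] b(1) W]
    by blast
qed

end
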